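(* Let $M\subset\mathbb{R}^N$ be a connected smooth $d$-manifold (compact, without boundary) and let $\mathcal{A}=\{(U_i,E_i,D_i)\}_{i\in I}$ be a smooth autoencoder atlas on $M$. Assume $\{U_i\}_{i\in I}$ forms a good cover. Then the following are equivalent: (1) The tangent bundle $\mathcal{T}_{\mathcal{A}}$ of the atlas is orientable. (2) The first Stiefel--Whitney class vanishes: $w_1(\mathcal{T}_{\mathcal{A}})=0\in H^1(M;\mathbb{Z}/2)$. (3) The Jacobian sign cocycle $\{\omega_{ji}\}$ is a Čech coboundary. (4) There exist signs $\nu_i\in\{\pm1\}$, one for each chart, such that $$\operatorname{sign}(\det g_{ji}(x))=\nu_j\cdot\nu_i\qquad\text{for all }x\in U_i\cap U_j.$$ Moreover, if $\mathcal{T}_{\mathcal{A}}\cong TM$, then these conditions are equivalent to orientability of $M$.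
   Context: A good cover is a finite open cover $\{U_i\}$ such that each $U_i$ is contractible and every connected component of every nonempty finite intersection is contractible (intersections may have several components). A smooth autoencoder chart on $M$ is a triple $(U,E,D)$ with $U\subset M$ open, $E:U\to Z\subset\mathbb{R}^d$ smooth and a diffeomorphism onto its image, $D:Z\to M$ smooth, and $D\circ E=\mathrm{Id}_U$. A smooth autoencoder atlas is a collection of such charts whose domains cover $M$. Transition maps are $T_{ji}=E_j\circ D_i:E_i(U_i\cap U_j)\to E_j(U_i\cap U_j)$, and the linearised transition functions are $g_{ji}(x)=d(T_{ji})_{E_i(x)}\in\mathrm{GL}_d(\mathbb{R})$, $x\in U_i\cap U_j$. The tangent bundle of the atlas is $\mathcal{T}_{\mathcal{A}}=\bigl(\bigsqcup_i U_i\times\mathbb{R}^d\bigr)/\sim$ with $(x,v)_i\sim(x,g_{ji}(x)v)_j$ for $x\in U_i\cap U_j$, a rank-$d$ vector bundle over $M$. The Jacobian sign cocycle is $\omega_{ji}(x)=\operatorname{sign}(\det g_{ji}(x))\in\{\pm1\}\cong\mathbb{Z}/2$. It is a Čech coboundary if there are locally constant functions $\nu_i:U_i\to\{\pm1\}$ with $\omega_{ji}=\nu_j\nu_i$ on every nonempty $U_i\cap U_j$. *)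

theory Defs
  imports "HOL-Analysis.Analysis" "HOL-Algebra.Group" "HOL-Library.Z2"
begin

section \<open>Smooth maps and submanifolds of Euclidean space\<close>

text \<open>\<open>cont_diff_on k f S\<close> (for open \<open>S\<close>): \<open>f\<close> is of class \<open>C\<^sup>k\<close> on \<open>S\<close>.\<close>

primrec cont_diff_on ::
    "nat \<Rightarrow> ('a::euclidean_space \<Rightarrow> 'b::euclidean_space) \<Rightarrow> 'a set \<Rightarrow> bool" where
  "cont_diff_on 0 f S \<longleftrightarrow> continuous_on S f"
| "cont_diff_on (Suc k) f S \<longleftrightarrow>
     (\<forall>x\<in>S. f differentiable (at x)) \<and>
     (\<forall>v. cont_diff_on k (\<lambda>x. frechet_derivative f (at x) v) S)"

text \<open>Smoothness on an arbitrary subset of a Euclidean space means, as usual, local extendability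
  to a \<open>C\<^sup>\<infinity>\<close> map on an open set of the ambient space.\<close>

definition smooth_map_on ::
    "'a::euclidean_space set \<Rightarrow> ('a \<Rightarrow> 'b::euclidean_space) \<Rightarrow> bool" where
  "smooth_map_on S f \<longleftrightarrow>
     (\<forall>x\<in>S. \<exists>W F. open W \<and> x \<in> W \<and> (\<forall>k. cont_diff_on k F W) \<and> (\<forall>y\<in>S \<inter> W. F y = f y))"

definition diffeomorphism_on ::
    "'a::euclidean_space set \<Rightarrow> 'b::euclidean_space set \<Rightarrow> ('a \<Rightarrow> 'b) \<Rightarrow> bool" where
  "diffeomorphism_on S T f \<longleftrightarrow>
     bij_betw f S T \<and> smooth_map_on S f \<and> smooth_map_on T (inv_into S f)"

definition manifold_chart ::
    "(real^'n) set \<Rightarrow> (real^'n) set \<Rightarrow> (real^'n \<Rightarrow> real^'d) \<Rightarrow> bool" where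
  "manifold_chart M V \<psi> \<longleftrightarrow>
     openin (top_of_set M) V \<and> open (\<psi> ` V) \<and> diffeomorphism_on V (\<psi> ` V) \<psi>"

text \<open>Smooth manifolds (without boundary) embedded in \<open>\<real>\<^sup>n\<close>; the dimension is \<open>CARD('d)\<close>,
  hence at least \<open>1\<close>.\<close>

definition smooth_manifold :: "'d::finite itself \<Rightarrow> (real^'n) set \<Rightarrow> bool" where
  "smooth_manifold (_ :: 'd itself) M \<longleftrightarrow>
     (\<forall>p\<in>M. \<exists>V (\<psi> :: real^'n \<Rightarrow> real^'d). p \<in> V \<and> manifold_chart M V \<psi>)"

definition orientable_manifold :: "'d::finite itself \<Rightarrow> (real^'n) set \<Rightarrow> bool" where
  "orientable_manifold (_ :: 'd itself) M \<longleftrightarrow>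
     (\<exists>\<C> :: ((real^'n) set \<times> (real^'n \<Rightarrow> real^'d)) set.
        (\<forall>(V, \<psi>)\<in>\<C>. manifold_chart M V \<psi>) \<and> M \<subseteq> \<Union>(fst ` \<C>) \<and>
        (\<forall>(V, \<psi>)\<in>\<C>. \<forall>(V', \<psi>')\<in>\<C>. \<forall>x\<in>V \<inter> V'.
           0 < det (jacobian (\<psi>' \<circ> inv_into V \<psi>) (at (\<psi> x) within \<psi> ` (V \<inter> V')))))"

definition tangent_space :: "(real^'n) set \<Rightarrow> real^'n \<Rightarrow> (real^'n) set" where
  "tangent_space M x =
     {v. \<exists>\<epsilon>>0. \<exists>\<gamma> :: real \<Rightarrow> real^'n. smooth_map_on {-\<epsilon><..<\<epsilon>} \<gamma> \<and> \<gamma> ` {-\<epsilon><..<\<epsilon>} \<subseteq> M \<and>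
        \<gamma> 0 = x \<and> (\<gamma> has_vector_derivative v) (at 0)}"


section \<open>Real vector bundles\<close>

text \<open>The operations are only meaningful on pairs of points in a common fibre.\<close>

record ('e, 'b) vbundle =
  total_space :: "'e topology"
  base_space :: "'b topology"
  proj :: "'e \<Rightarrow> 'b"
  fadd :: "'e \<Rightarrow> 'e \<Rightarrow> 'e"
  fscale :: "real \<Rightarrow> 'e \<Rightarrow> 'e"

definition fibre :: "('e, 'b) vbundle \<Rightarrow> 'b \<Rightarrow> 'e set" where
  "fibre \<xi> x = {e \<in> topspace (total_space \<xi>). proj \<xi> e = x}"

text \<open>A frame at \<open>x\<close> is a linear isomorphism from \<open>\<real>\<^sup>d\<close> onto the fibre over \<open>x\<close>.\<close>

definition frame_at :: "('e, 'b) vbundle \<Rightarrow> 'b \<Rightarrow> (real^'d \<Rightarrow> 'e) \<Rightarrow> bool" where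
  "frame_at \<xi> x f \<longleftrightarrow> bij_betw f UNIV (fibre \<xi> x) \<and>
     (\<forall>v w. f (v + w) = fadd \<xi> (f v) (f w)) \<and> (\<forall>a v. f (a *\<^sub>R v) = fscale \<xi> a (f v))"

definition frame_change :: "(real^'d \<Rightarrow> 'e) \<Rightarrow> (real^'d \<Rightarrow> 'e) \<Rightarrow> real^'d^'d" where
  "frame_change f g = (THE A. \<forall>v. f v = g (A *v v))"

definition local_trivialization ::
    "('e, 'b) vbundle \<Rightarrow> 'b set \<Rightarrow> ('b \<times> (real^'d) \<Rightarrow> 'e) \<Rightarrow> bool" where
  "local_trivialization \<xi> V \<phi> \<longleftrightarrow> openin (base_space \<xi>) V \<and>
     homeomorphic_map (prod_topology (subtopology (base_space \<xi>) V) euclidean)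
       (subtopology (total_space \<xi>) {e \<in> topspace (total_space \<xi>). proj \<xi> e \<in> V}) \<phi> \<and>
     (\<forall>x\<in>V. frame_at \<xi> x (\<lambda>v. \<phi> (x, v)))"

definition fibre_orientation :: "('e, 'b) vbundle \<Rightarrow> 'b \<Rightarrow> (real^'d \<Rightarrow> 'e) set \<Rightarrow> bool" where
  "fibre_orientation \<xi> x \<O> \<longleftrightarrow>
     (\<exists>f. frame_at \<xi> x f \<and> \<O> = {g. frame_at \<xi> x g \<and> 0 < det (frame_change f g)})"

text \<open>An orientation is a choice of orientations of all fibres which near every point of the base
  is induced by some local trivialization. The type argument fixes the rank.\<close>

definition orientable_bundle :: "'d::finite itself \<Rightarrow> ('e, 'b) vbundle \<Rightarrow> bool" where
  "orientable_bundle (_ :: 'd itself) \<xi> \<longleftrightarrow>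
     (\<exists>\<O> :: 'b \<Rightarrow> (real^'d \<Rightarrow> 'e) set.
        (\<forall>x\<in>topspace (base_space \<xi>). fibre_orientation \<xi> x (\<O> x)) \<and>
        (\<forall>x\<in>topspace (base_space \<xi>). \<exists>V \<phi>. x \<in> V \<and> local_trivialization \<xi> V \<phi> \<and>
            (\<forall>y\<in>V. (\<lambda>v. \<phi> (y, v)) \<in> \<O> y)))"

definition bundle_isomorphic ::
    "('e, 'b) vbundle \<Rightarrow> ('f, 'b) vbundle \<Rightarrow> bool" where
  "bundle_isomorphic \<xi> \<eta> \<longleftrightarrow> base_space \<xi> = base_space \<eta> \<and>
     (\<exists>F. homeomorphic_map (total_space \<xi>) (total_space \<eta>) F \<and>
        (\<forall>e\<in>topspace (total_space \<xi>). proj \<eta> (F e) = proj \<xi> e) \<and>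
        (\<forall>x\<in>topspace (base_space \<xi>). \<forall>e\<in>fibre \<xi> x. \<forall>e'\<in>fibre \<xi> x.
            F (fadd \<xi> e e') = fadd \<eta> (F e) (F e')) \<and>
        (\<forall>e\<in>topspace (total_space \<xi>). \<forall>a. F (fscale \<xi> a e) = fscale \<eta> a (F e)))"

definition tangent_bundle :: "(real^'n) set \<Rightarrow> ((real^'n) \<times> (real^'n), real^'n) vbundle" where
  "tangent_bundle M =
     \<lparr> total_space = top_of_set (Sigma M (tangent_space M)), base_space = top_of_set M, proj = fst,
       fadd = (\<lambda>e e'. (fst e, snd e + snd e')), fscale = (\<lambda>a e. (fst e, a *\<^sub>R snd e)) \<rparr>"


section \<open>First Cech cohomology with constant coefficients\<close>

definition locally_constant_on :: "'b topology \<Rightarrow> 'b set \<Rightarrow> ('b \<Rightarrow> 'c) \<Rightarrow> bool" where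
  "locally_constant_on X S f \<longleftrightarrow>
     (\<forall>x\<in>S. \<exists>W. openin X W \<and> x \<in> W \<and> (\<forall>y\<in>W \<inter> S. f y = f x))"

text \<open>\<open>H\<^sup>1(X; G)\<close> is the direct limit of the Cech groups of the open covers of \<open>X\<close>. Following
  Godement, only covers indexed by the points of \<open>X\<close>, with \<open>p \<in> U p\<close>, are used: they are cofinal
  among all open covers, and they form a directed set with canonical refinement maps (the identity
  on indices). A class is represented by a pair of a cover and a cocycle of locally constant
  functions on it; the values of a cocycle outside its domain are irrelevant. On manifolds this group agrees
  with singular cohomology.\<close>

definition point_cover :: "'b topology \<Rightarrow> ('b \<Rightarrow> 'b set) \<Rightarrow> bool" where
  "point_cover X U \<longleftrightarrow> (\<forall>p\<in>topspace X. openin X (U p) \<and> p \<in> U p)"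

definition cech_cocycles ::
    "'b topology \<Rightarrow> (('b \<Rightarrow> 'b set) \<times> ('b \<Rightarrow> 'b \<Rightarrow> 'b \<Rightarrow> 'g::ab_group_add)) set" where
  "cech_cocycles X = {(U, c). point_cover X U \<and>
     (\<forall>p\<in>topspace X. \<forall>q\<in>topspace X. locally_constant_on X (U p \<inter> U q) (c p q)) \<and>
     (\<forall>p\<in>topspace X. \<forall>q\<in>topspace X. \<forall>r\<in>topspace X. \<forall>x\<in>U p \<inter> U q \<inter> U r.
        c p q x + c q r x = c p r x)}"

definition cech_rel ::
    "'b topology \<Rightarrow> (('b \<Rightarrow> 'b set) \<times> ('b \<Rightarrow> 'b \<Rightarrow> 'b \<Rightarrow> 'g::ab_group_add)) rel" where
  "cech_rel X = {((U, c), (V, c')). (U, c) \<in> cech_cocycles X \<and> (V, c') \<in> cech_cocycles X \<and>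
     (\<exists>W n. point_cover X W \<and> (\<forall>p\<in>topspace X. W p \<subseteq> U p \<inter> V p) \<and>
        (\<forall>p\<in>topspace X. locally_constant_on X (W p) (n p)) \<and>
        (\<forall>p\<in>topspace X. \<forall>q\<in>topspace X. \<forall>x\<in>W p \<inter> W q.
           c p q x - c' p q x = n q x - n p x))}"

text \<open>The group is written as an HOL-Algebra monoid, so its zero class is \<open>\<one>\<close>.\<close>

definition cech_H1 ::
    "'b topology \<Rightarrow> (('b \<Rightarrow> 'b set) \<times> ('b \<Rightarrow> 'b \<Rightarrow> 'b \<Rightarrow> 'g::ab_group_add)) set monoid" where
  "cech_H1 X =
     \<lparr> carrier = cech_cocycles X // cech_rel X,
       mult = (\<lambda>A B. \<Union>(U, c)\<in>A. \<Union>(V, c')\<in>B.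
                cech_rel X `` {(\<lambda>p. U p \<inter> V p, \<lambda>p q x. c p q x + c' p q x)}),
       one = cech_rel X `` {(\<lambda>p. topspace X, \<lambda>p q x. 0)} \<rparr>"

text \<open>The class \<open>w\<^sub>1\<close> is the image of the bundle under
  \<open>H\<^sup>1(X; GL\<^sub>d) \<rightarrow> H\<^sup>1(X; {\<plusminus>1}) = H\<^sup>1(X; \<int>/2)\<close>, i.e. it is represented by the sign of the determinant
  of the transition functions of an arbitrary system of local trivializations. All such systems
  give the same class.\<close>

definition stiefel_whitney_1 ::
    "'d::finite itself \<Rightarrow> ('e, 'b) vbundle \<Rightarrow>
       (('b \<Rightarrow> 'b set) \<times> ('b \<Rightarrow> 'b \<Rightarrow> 'b \<Rightarrow> bit)) set" where
  "stiefel_whitney_1 (_ :: 'd itself) \<xi> =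
     (THE a. \<exists>U (\<phi> :: 'b \<Rightarrow> 'b \<times> (real^'d) \<Rightarrow> 'e).
        (\<forall>p\<in>topspace (base_space \<xi>). p \<in> U p \<and> local_trivialization \<xi> (U p) (\<phi> p)) \<and>
        a = cech_rel (base_space \<xi>) ``
              {(U, \<lambda>p q x. if det (frame_change (\<lambda>v. \<phi> p (x, v)) (\<lambda>v. \<phi> q (x, v))) < 0
                           then 1 else 0)})"


section \<open>Smooth autoencoder atlases\<close>

text \<open>\<open>Z\<close> is the latent space; the encoder and decoder are total functions whose values matter only
  on \<open>U\<close> and \<open>Z\<close> respectively.\<close>

definition smooth_autoencoder_chart ::
    "(real^'n) set \<Rightarrow> (real^'n) set \<Rightarrow> (real^'d) set \<Rightarrow>
       (real^'n \<Rightarrow> real^'d) \<Rightarrow> (real^'d \<Rightarrow> real^'n) \<Rightarrow> bool" where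
  "smooth_autoencoder_chart M U Z E D \<longleftrightarrow>
     openin (top_of_set M) U \<and>
     E ` U \<subseteq> Z \<and> smooth_map_on U E \<and> diffeomorphism_on U (E ` U) E \<and>
     D ` Z \<subseteq> M \<and> smooth_map_on Z D \<and> (\<forall>x\<in>U. D (E x) = x)"

definition smooth_autoencoder_atlas ::
    "(real^'n) set \<Rightarrow> 'i set \<Rightarrow> ('i \<Rightarrow> (real^'n) set) \<Rightarrow> ('i \<Rightarrow> (real^'d) set) \<Rightarrow>
       ('i \<Rightarrow> real^'n \<Rightarrow> real^'d) \<Rightarrow> ('i \<Rightarrow> real^'d \<Rightarrow> real^'n) \<Rightarrow> bool" where
  "smooth_autoencoder_atlas M I U Z E D \<longleftrightarrow>
     (\<forall>i\<in>I. smooth_autoencoder_chart M (U i) (Z i) (E i) (D i)) \<and> (\<Union>i\<in>I. U i) = M"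

definition good_cover :: "(real^'n) set \<Rightarrow> 'i set \<Rightarrow> ('i \<Rightarrow> (real^'n) set) \<Rightarrow> bool" where
  "good_cover M I U \<longleftrightarrow>
     finite I \<and> (\<forall>i\<in>I. openin (top_of_set M) (U i)) \<and> (\<Union>i\<in>I. U i) = M \<and>
     (\<forall>i\<in>I. contractible (U i)) \<and>
     (\<forall>J. J \<subseteq> I \<and> J \<noteq> {} \<and> (\<Inter>j\<in>J. U j) \<noteq> {} \<longrightarrow>
        (\<forall>C\<in>components (\<Inter>j\<in>J. U j). contractible C))"

text \<open>\<open>lin_transition U E D j i x\<close> is the differential at \<open>E\<^sub>i x\<close> of the transition map
  \<open>E\<^sub>j \<circ> D\<^sub>i\<close> on \<open>E\<^sub>i (U\<^sub>i \<inter> U\<^sub>j)\<close>, as a matrix.\<close>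

definition lin_transition ::
    "('i \<Rightarrow> (real^'n) set) \<Rightarrow> ('i \<Rightarrow> real^'n \<Rightarrow> real^'d) \<Rightarrow> ('i \<Rightarrow> real^'d \<Rightarrow> real^'n) \<Rightarrow>
       'i \<Rightarrow> 'i \<Rightarrow> real^'n \<Rightarrow> real^'d^'d" where
  "lin_transition U E D j i x = jacobian (E j \<circ> D i) (at (E i x) within E i ` (U i \<inter> U j))"

definition jacobian_sign ::
    "('i \<Rightarrow> (real^'n) set) \<Rightarrow> ('i \<Rightarrow> real^'n \<Rightarrow> real^'d) \<Rightarrow> ('i \<Rightarrow> real^'d \<Rightarrow> real^'n) \<Rightarrow>
       'i \<Rightarrow> 'i \<Rightarrow> real^'n \<Rightarrow> real" where
  "jacobian_sign U E D j i x = sgn (det (lin_transition U E D j i x))"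

definition sign_coboundary ::
    "(real^'n) set \<Rightarrow> 'i set \<Rightarrow> ('i \<Rightarrow> (real^'n) set) \<Rightarrow> ('i \<Rightarrow> 'i \<Rightarrow> real^'n \<Rightarrow> real) \<Rightarrow> bool" where
  "sign_coboundary M I U \<omega> \<longleftrightarrow>
     (\<exists>\<nu> :: 'i \<Rightarrow> real^'n \<Rightarrow> real.
        (\<forall>i\<in>I. locally_constant_on (top_of_set M) (U i) (\<nu> i) \<and> \<nu> i ` U i \<subseteq> {-1, 1}) \<and>
        (\<forall>i\<in>I. \<forall>j\<in>I. \<forall>x\<in>U i \<inter> U j. \<omega> j i x = \<nu> j x * \<nu> i x))"

definition quotient_topology :: "'c topology \<Rightarrow> 'c rel \<Rightarrow> 'c set topology" where
  "quotient_topology X R = topology (\<lambda>\<U>. \<U> \<subseteq> topspace X // R \<and> openin X (\<Union>\<U>))"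

text \<open>This yields the quotient topology whenever \<open>R\<close> is an equivalence relation.\<close>

lemma istopology_quotient:
  assumes R: "equiv (topspace X) R"
  shows "istopology (\<lambda>\<U>. \<U> \<subseteq> topspace X // R \<and> openin X (\<Union>\<U>))"
  unfolding istopology_def
proof (intro conjI allI impI)
  fix S T
  assume S: "S \<subseteq> topspace X // R \<and> openin X (\<Union>S)" and T: "T \<subseteq> topspace X // R \<and> openin X (\<Union>T)"
  show "S \<inter> T \<subseteq> topspace X // R" using S by blast
  have "\<Union>(S \<inter> T) = \<Union>S \<inter> \<Union>T"
  proof
    show "\<Union>S \<inter> \<Union>T \<subseteq> \<Union>(S \<inter> T)"
    proof
      fix x assume "x \<in> \<Union>S \<inter> \<Union>T"
      then obtain A B where "A \<in> S" "x \<in> A" "B \<in> T" "x \<in> B" by blast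
      moreover have "A = B"
        using quotient_disj[OF R, of A B] S T calculation by blast
      ultimately show "x \<in> \<Union>(S \<inter> T)" by blast
    qed
  qed blast
  then show "openin X (\<Union>(S \<inter> T))" using S T by auto
next
  fix \<K>
  assume "\<forall>K\<in>\<K>. K \<subseteq> topspace X // R \<and> openin X (\<Union>K)"
  then show "\<Union>\<K> \<subseteq> topspace X // R" "openin X (\<Union>(\<Union>\<K>))"
    by (blast, smt (verit) Sup_upper UnionE UnionI openin_subopen subset_eq)
qed

definition atlas_space :: "(real^'n) set \<Rightarrow> 'i set \<Rightarrow> ('i \<Rightarrow> (real^'n) set) \<Rightarrow>
       ('i \<times> (real^'n) \<times> (real^'d)) topology" where
  "atlas_space M I U =
     sum_topology (\<lambda>i. prod_topology (subtopology (top_of_set M) (U i)) euclidean) I"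

definition atlas_rel ::
    "'i set \<Rightarrow> ('i \<Rightarrow> (real^'n) set) \<Rightarrow> ('i \<Rightarrow> real^'n \<Rightarrow> real^'d) \<Rightarrow>
       ('i \<Rightarrow> real^'d \<Rightarrow> real^'n) \<Rightarrow> ('i \<times> (real^'n) \<times> (real^'d)) rel" where
  "atlas_rel I U E D =
     {((i, x, v), (j, x, lin_transition U E D j i x *v v)) | i j x v.
        i \<in> I \<and> j \<in> I \<and> x \<in> U i \<inter> U j}"

text \<open>Points of the total space are equivalence classes. Each class contains exactly one triple
  \<open>(i, x, v)\<close> for every chart \<open>i\<close> whose domain contains the base point \<open>x\<close>, so the fibrewise
  operations can be carried out representative by representative.\<close>

definition atlas_bundle ::
    "(real^'n) set \<Rightarrow> 'i set \<Rightarrow> ('i \<Rightarrow> (real^'n) set) \<Rightarrow>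
       ('i \<Rightarrow> real^'n \<Rightarrow> real^'d) \<Rightarrow> ('i \<Rightarrow> real^'d \<Rightarrow> real^'n) \<Rightarrow>
       (('i \<times> (real^'n) \<times> (real^'d)) set, real^'n) vbundle" where
  "atlas_bundle M I U E D =
     \<lparr> total_space = quotient_topology (atlas_space M I U) (atlas_rel I U E D),
       base_space = top_of_set M,
       proj = (\<lambda>e. THE x. \<exists>i v. (i, x, v) \<in> e),
       fadd = (\<lambda>e e'. {(i, x, v + w) | i x v w. (i, x, v) \<in> e \<and> (i, x, w) \<in> e'}),
       fscale = (\<lambda>a e. {(i, x, a *\<^sub>R v) | i x v. (i, x, v) \<in> e}) \<rparr>"

end

theory Submission
  imports Defs
begin

text \<open>Whether a bundle is orientable can be read off from any family of local trivializations
  \<open>\<phi>\<^sub>i\<close> covering the base: it is orientable iff the signs of the determinants of the frame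
  changes have the form \<open>\<nu>\<^sub>j \<nu>\<^sub>i\<close> with locally constant \<open>\<nu>\<^sub>i\<close>, where \<open>\<nu>\<^sub>i\<close> records whether
  \<open>\<phi>\<^sub>i\<close> preserves the orientation. Applied to the tautological trivializations of the atlas
  bundle, whose frame changes are the linearised transitions, this is (1) \<open>\<longleftrightarrow>\<close> (3); applied to a
  family indexed by the points of the base, it is (1) \<open>\<longleftrightarrow>\<close> (2), because the class \<open>w\<^sub>1\<close>
  vanishes iff its sign cocycle splits on some refinement. Contractible chart domains are
  connected, so there a locally constant sign is constant, which is (3) \<open>\<longleftrightarrow>\<close> (4).

  By invariance of domain the encoders are manifold charts of \<open>M\<close>. Comparing them with an oriented
  atlas gives signs as in (3), and conversely flipping the encoders with \<open>\<nu>\<^sub>i = -1\<close> yields an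
  oriented atlas.\<close>

section \<open>Locally constant functions\<close>

text \<open>The preimage of the open half-line containing \<open>f x\<close> is a neighbourhood of
  \<open>x\<close> on which the sign does not change. It is open in \<open>S\<close>, hence in
  \<open>X\<close> because \<open>S\<close> is open.\<close>

lemma locally_constant_on_sgn:
  fixes f :: "'b \<Rightarrow> real"
  assumes f: "continuous_map (subtopology X S) euclideanreal f" and S: "openin X S"
    and nz: "\<And>x. x \<in> S \<Longrightarrow> f x \<noteq> 0"
  shows "locally_constant_on X S (\<lambda>x. sgn (f x))"
  unfolding locally_constant_on_def
proof
  fix x assume x: "x \<in> S"
  define T :: "real set" where "T = (if 0 < f x then {0<..} else {..<0})"
  define W where "W = {y \<in> topspace (subtopology X S). f y \<in> T}"
  have "openin (subtopology X S) W"
    unfolding W_def by (rule openin_continuous_map_preimage[OF f]) (auto simp: T_def)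
  then have "openin X W" using openin_open_subtopology[OF S] by blast
  moreover have "x \<in> W"
    using x nz[OF x] openin_subset[OF S] by (auto simp: W_def T_def)
  moreover have "\<forall>y\<in>W \<inter> S. sgn (f y) = sgn (f x)"
    using nz[OF x] by (auto simp: W_def T_def split: if_splits)
  ultimately show "\<exists>W. openin X W \<and> x \<in> W \<and> (\<forall>y\<in>W \<inter> S. sgn (f y) = sgn (f x))" by blast
qed

lemma locally_constant_on_subset:
  "locally_constant_on X T f \<Longrightarrow> S \<subseteq> T \<Longrightarrow> locally_constant_on X S f"
  unfolding locally_constant_on_def by (meson IntD1 IntD2 IntI subsetD)

lemma locally_constant_on_const: "S \<subseteq> topspace X \<Longrightarrow> locally_constant_on X S (\<lambda>_. c)"
  unfolding locally_constant_on_def by (metis openin_topspace subsetD)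

lemma locally_constant_on_compose:
  assumes "locally_constant_on X S f" shows "locally_constant_on X S (\<lambda>x. h (f x))"
  using assms unfolding locally_constant_on_def by metis

lemma locally_constant_on_combine:
  assumes "locally_constant_on X S f" "locally_constant_on X S g"
  shows "locally_constant_on X S (\<lambda>x. h (f x) (g x))"
  unfolding locally_constant_on_def
proof
  fix x assume "x \<in> S"
  then obtain V W where "openin X V" "x \<in> V" "\<forall>y\<in>V \<inter> S. f y = f x"
      "openin X W" "x \<in> W" "\<forall>y\<in>W \<inter> S. g y = g x"
    using assms unfolding locally_constant_on_def by meson
  then show "\<exists>W. openin X W \<and> x \<in> W \<and> (\<forall>y\<in>W \<inter> S. h (f y) (g y) = h (f x) (g x))"
    by (intro exI[of _ "V \<inter> W"]) auto
qed

lemma locally_constant_on_connected: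
  assumes f: "locally_constant_on (top_of_set M) S f" and S: "S \<subseteq> M" "connected S"
    and xy: "x \<in> S" "y \<in> S"
  shows "f x = f y"
proof -
  have "f constant_on S"
  proof (rule locally_constant_imp_constant[OF S(2)])
    fix a assume a: "a \<in> S"
    then obtain W where W: "openin (top_of_set M) W" "a \<in> W" "\<forall>y\<in>W \<inter> S. f y = f a"
      using f unfolding locally_constant_on_def by blast
    obtain T where "open T" "W = M \<inter> T" using W(1) openin_open by blast
    then have "openin (top_of_set S) (S \<inter> W)"
      using S(1) by (auto simp: openin_open)
    then show "\<exists>T. openin (top_of_set S) T \<and> a \<in> T \<and> (\<forall>x\<in>T. f x = f a)"
      using W a by blast
  qed
  then show ?thesis using xy unfolding constant_on_def by metis
qed

section \<open>Frames and orientations of vector bundles\<close>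

text \<open>Composing \<open>f\<close> with the inverse of \<open>g\<close> gives a linear map of
  the coordinate space to itself, and its matrix is the only candidate. This makes the definite
  description in \<open>frame_change\<close> meaningful.\<close>

lemma frame_change_ex1:
  fixes f g :: "real^'d \<Rightarrow> 'e"
  assumes f: "frame_at \<xi> x f" and g: "frame_at \<xi> x g"
  shows "\<exists>!A. \<forall>v. f v = g (A *v v)"
proof -
  have ginj: "inj g" and im: "range f = range g"
    using f g by (auto simp: frame_at_def bij_betw_def)
  define h where "h = (\<lambda>v. inv_into UNIV g (f v))"
  have gh: "g (h v) = f v" for v
    unfolding h_def using im by (metis f_inv_into_f rangeI)
  have "linear h"
  proof (rule linearI)
    fix v w show "h (v + w) = h v + h w"
      by (rule injD[OF ginj]) (metis f g gh frame_at_def)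
  next
    fix a v show "h (a *\<^sub>R v) = a *\<^sub>R h v"
      by (rule injD[OF ginj]) (metis f g gh frame_at_def)
  qed
  then have h: "matrix h *v v = h v" for v by (simp add: linear_matrix_vector_mul_eq)
  show ?thesis
  proof (rule ex1I[of _ "matrix h"])
    show "\<forall>v. f v = g (matrix h *v v)" by (simp add: h gh)
    show "A = matrix h" if "\<forall>v. f v = g (A *v v)" for A
      unfolding matrix_eq by (metis gh ginj h injD that)
  qed
qed

lemma frame_change_works:
  assumes "frame_at \<xi> x f" "frame_at \<xi> x g"
  shows "f v = g (frame_change f g *v v)"
  using theI'[OF frame_change_ex1[OF assms]] unfolding frame_change_def by blast

lemma frame_change_eqI:
  assumes "frame_at \<xi> x f" "frame_at \<xi> x g" "\<And>v. f v = g (A *v v)"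
  shows "frame_change f g = A"
  unfolding frame_change_def by (rule the1_equality[OF frame_change_ex1[OF assms(1,2)]]) (simp add: assms(3))

lemma frame_change_self: "frame_at \<xi> x f \<Longrightarrow> frame_change f f = mat 1"
  by (rule frame_change_eqI) auto

lemma frame_change_trans:
  assumes "frame_at \<xi> x f" "frame_at \<xi> x g" "frame_at \<xi> x h"
  shows "frame_change f h = frame_change g h ** frame_change f g"
  by (rule frame_change_eqI[OF assms(1,3)])
    (metis assms frame_change_works matrix_vector_mul_assoc)

definition frame_sign :: "(real^'d \<Rightarrow> 'e) \<Rightarrow> (real^'d \<Rightarrow> 'e) \<Rightarrow> real" where
  "frame_sign f g = sgn (det (frame_change f g))"

lemma frame_sign_self: "frame_at \<xi> x f \<Longrightarrow> frame_sign f f = 1"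
  by (simp add: frame_sign_def frame_change_self)

text \<open>Multiplicativity of the determinant. This is the cocycle identity on which all later
  computations with frames rest.\<close>

lemma frame_sign_trans:
  assumes "frame_at \<xi> x f" "frame_at \<xi> x g" "frame_at \<xi> x h"
  shows "frame_sign f g * frame_sign g h = frame_sign f h"
  by (simp add: frame_sign_def frame_change_trans[OF assms] det_mul sgn_mult)

text \<open>Changing from \<open>f\<close> to \<open>g\<close> and back is the identity, so the
  product of the two determinants is 1.\<close>

lemma det_frame_change_nonzero:
  assumes "frame_at \<xi> x f" "frame_at \<xi> x g"
  shows "det (frame_change f g) \<noteq> 0"
  using frame_change_trans[OF assms(1,2,1)] frame_change_self[OF assms(1)]
  by (metis det_I det_mul mult_zero_right zero_neq_one)

lemma frame_sign_cases:
  assumes "frame_at \<xi> x f" "frame_at \<xi> x g"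
  shows "frame_sign f g = 1 \<or> frame_sign f g = -1"
  using det_frame_change_nonzero[OF assms] by (auto simp: frame_sign_def sgn_real_def)

lemma frame_change_pos_iff: "0 < det (frame_change f g) \<longleftrightarrow> frame_sign f g = 1"
  by (simp add: frame_sign_def sgn_real_def)

section \<open>Local trivializations: continuity of frame changes, restriction, linear change of the
  fibre coordinate\<close>

lemma local_trivialization_frame:
  "local_trivialization \<xi> V \<phi> \<Longrightarrow> x \<in> V \<Longrightarrow> frame_at \<xi> x (\<lambda>v. \<phi> (x, v))"
  by (simp add: local_trivialization_def)

lemma frame_at_mem:
  "frame_at \<xi> x f \<Longrightarrow> f v \<in> topspace (total_space \<xi>) \<and> proj \<xi> (f v) = x"
  unfolding frame_at_def bij_betw_def fibre_def by blast

text \<open>The columns of the frame change are obtained by sending basis vectors through \<phi> and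
  reading off their fibre coordinates in \<psi>. Both operations are continuous, and the determinant
  is a polynomial in the entries.\<close>

lemma continuous_map_det_frame_change:
  fixes \<phi> \<psi> :: "'b \<times> (real^'d) \<Rightarrow> 'e"
  assumes \<phi>: "local_trivialization \<xi> V \<phi>" and \<psi>: "local_trivialization \<xi> W \<psi>"
  shows "continuous_map (subtopology (base_space \<xi>) (V \<inter> W)) euclideanreal
           (\<lambda>x. det (frame_change (\<lambda>v. \<phi> (x, v)) (\<lambda>v. \<psi> (x, v))))"
proof -
  let ?X = "subtopology (base_space \<xi>) (V \<inter> W)"
  let ?E = "\<lambda>V. subtopology (total_space \<xi>) {e \<in> topspace (total_space \<xi>). proj \<xi> e \<in> V}"
  define A where "A x = frame_change (\<lambda>v. \<phi> (x, v)) (\<lambda>v. \<psi> (x, v))" for x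
  have c\<phi>: "continuous_map (prod_topology (subtopology (base_space \<xi>) V) euclidean) (?E V) \<phi>"
    using \<phi> by (auto simp: local_trivialization_def intro: homeomorphic_imp_continuous_map)
  obtain \<psi>' where \<psi>': "homeomorphic_maps (prod_topology (subtopology (base_space \<xi>) W) euclidean) (?E W) \<psi> \<psi>'"
    using \<psi> by (auto simp: local_trivialization_def homeomorphic_map_maps)
  \<comment> \<open>For fixed \<open>v\<close>, the vector \<open>A x *v v\<close> is the fibre
    coordinate of \<open>\<phi> (x, v)\<close> with respect to \<psi>.\<close>
  have A: "continuous_map ?X euclidean (\<lambda>x. A x *v v)" for v
  proof -
    have 1: "continuous_map ?X (prod_topology (subtopology (base_space \<xi>) V) euclidean) (\<lambda>x. (x, v))"
      by (auto simp: continuous_map_pairwise o_def intro!: continuous_map_into_subtopology)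
    have "continuous_map ?X (?E V) (\<lambda>x. \<phi> (x, v))"
      using continuous_map_compose[OF 1 c\<phi>] by (simp add: o_def)
    then have "continuous_map ?X (total_space \<xi>) (\<lambda>x. \<phi> (x, v))"
      using continuous_map_into_fulltopology by blast
    then have 2: "continuous_map ?X (?E W) (\<lambda>x. \<phi> (x, v))"
      using frame_at_mem[OF local_trivialization_frame[OF \<phi>]]
      by (auto intro!: continuous_map_into_subtopology)
    have "continuous_map (?E W) (prod_topology (subtopology (base_space \<xi>) W) euclidean) \<psi>'"
      using \<psi>' by (simp add: homeomorphic_maps_def)
    then have 3: "continuous_map ?X euclidean (\<lambda>x. snd (\<psi>' (\<phi> (x, v))))"
      using continuous_map_snd_of[OF continuous_map_compose[OF 2]] by (simp add: o_def)
    have "snd (\<psi>' (\<phi> (x, v))) = A x *v v" if "x \<in> topspace ?X" for x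
    proof -
      have x: "x \<in> V" "x \<in> W" "x \<in> topspace (base_space \<xi>)" using that by auto
      have "\<phi> (x, v) = \<psi> (x, A x *v v)"
        unfolding A_def by (rule frame_change_works[OF local_trivialization_frame[OF \<phi> x(1)]
              local_trivialization_frame[OF \<psi> x(2)]])
      moreover have "\<psi>' (\<psi> (x, A x *v v)) = (x, A x *v v)"
        using \<psi>' x by (simp add: homeomorphic_maps_def)
      ultimately show ?thesis by simp
    qed
    then show ?thesis by (rule continuous_map_eq[OF 3])
  qed
  have ent: "continuous_map ?X euclideanreal (\<lambda>x. A x $ i $ j)" for i j
  proof -
    have "continuous_map euclidean euclideanreal (\<lambda>v::real^'d. v $ i)"
      by (simp add: continuous_on_component)
    from continuous_map_compose[OF A[of "axis j 1"] this] show ?thesis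
      by (simp add: o_def matrix_vector_mult_basis column_def)
  qed
  show ?thesis
    unfolding det_def A_def[symmetric]
    by (intro continuous_map_sum continuous_map_real_mult continuous_map_prod ent) (auto simp: finite_permutations)
qed

lemma locally_constant_frame_sign:
  assumes "local_trivialization \<xi> V \<phi>" "local_trivialization \<xi> W \<psi>"
  shows "locally_constant_on (base_space \<xi>) (V \<inter> W)
           (\<lambda>x. frame_sign (\<lambda>v. \<phi> (x, v)) (\<lambda>v. \<psi> (x, v)))"
  unfolding frame_sign_def
  using continuous_map_det_frame_change[OF assms]
proof (rule locally_constant_on_sgn)
  show "openin (base_space \<xi>) (V \<inter> W)" using assms by (auto simp: local_trivialization_def)
  show "det (frame_change (\<lambda>v. \<phi> (x, v)) (\<lambda>v. \<psi> (x, v))) \<noteq> 0" if "x \<in> V \<inter> W" for x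
    using det_frame_change_nonzero[OF assms[THEN local_trivialization_frame], of x] that by blast
qed

text \<open>A trivialization preserves base points, so it matches the part of the product over
  \<open>W\<close> with exactly the part of the total space over \<open>W\<close>.\<close>

lemma local_trivialization_restrict:
  fixes \<phi> :: "'b \<times> (real^'d) \<Rightarrow> 'e"
  assumes \<phi>: "local_trivialization \<xi> V \<phi>" and W: "openin (base_space \<xi>) W" "W \<subseteq> V"
  shows "local_trivialization \<xi> W \<phi>"
proof -
  let ?T = "\<lambda>V. {e \<in> topspace (total_space \<xi>). proj \<xi> e \<in> V}"
  let ?P = "\<lambda>V. prod_topology (subtopology (base_space \<xi>) V) (euclidean :: (real^'d) topology)"
  have "homeomorphic_map (subtopology (?P V) (W \<times> UNIV)) (subtopology (subtopology (total_space \<xi>) (?T V)) (?T W)) \<phi>"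
  proof (rule homeomorphic_map_subtopologies_alt)
    show "homeomorphic_map (?P V) (subtopology (total_space \<xi>) (?T V)) \<phi>"
      using \<phi> by (simp add: local_trivialization_def)
    show "\<phi> p \<in> ?T W \<longleftrightarrow> p \<in> W \<times> UNIV" if "p \<in> topspace (?P V)" for p
      using that frame_at_mem[OF local_trivialization_frame[OF \<phi>], of "fst p" "snd p"] by (cases p) auto
  qed
  moreover have "subtopology (?P V) (W \<times> UNIV) = ?P W"
    using W(2) by (simp add: subtopology_Times subtopology_subtopology Int_absorb1)
  moreover have "subtopology (subtopology (total_space \<xi>) (?T V)) (?T W) = subtopology (total_space \<xi>) (?T W)"
    unfolding subtopology_subtopology by (rule arg_cong[where f = "subtopology _"]) (use W(2) in auto)
  ultimately show ?thesis
    using \<phi> W by (auto simp: local_trivialization_def)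
qed

lemma frame_at_matrix:
  assumes f: "frame_at \<xi> x f" and A: "det (A :: real^'d^'d) \<noteq> 0"
  shows "frame_at \<xi> x (\<lambda>v. f (A *v v))"
proof -
  have "bij ((*v) A)" using A by (simp add: invertible_eq_bij[symmetric] invertible_det_nz)
  then have "bij_betw (f \<circ> (*v) A) UNIV (fibre \<xi> x)"
    using f by (auto simp: frame_at_def intro: bij_betw_trans)
  then show ?thesis
    using f by (simp add: frame_at_def o_def matrix_vector_right_distrib matrix_vector_mult_scaleR)
qed

lemma frame_sign_matrix:
  assumes "frame_at \<xi> x f" "det (A :: real^'d^'d) \<noteq> 0"
  shows "frame_sign (\<lambda>v. f (A *v v)) f = sgn (det A)"
  unfolding frame_sign_def using frame_change_eqI[OF frame_at_matrix[OF assms] assms(1)] by metis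

text \<open>An invertible constant matrix acts as a self-homeomorphism of the product, with the
  inverse matrix as its inverse. With \<open>sign_matrix\<close> for \<open>A\<close>, this reverses
  the orientation that a trivialization induces.\<close>

lemma local_trivialization_matrix:
  fixes \<phi> :: "'b \<times> (real^'d) \<Rightarrow> 'e"
  assumes \<phi>: "local_trivialization \<xi> V \<phi>" and A: "det A \<noteq> 0"
  shows "local_trivialization \<xi> V (\<lambda>(x, v). \<phi> (x, A *v v))"
proof -
  let ?P = "prod_topology (subtopology (base_space \<xi>) V) (euclidean :: (real^'d) topology)"
  obtain B where B: "A ** B = mat 1" "B ** A = mat 1"
    using A unfolding invertible_det_nz[symmetric] invertible_def by blast
  have cont: "continuous_map euclidean euclidean ((*v) C)" for C :: "real^'d^'d"
    by (simp add: linear_continuous_on)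
  have "homeomorphic_maps euclidean euclidean ((*v) A) ((*v) B)"
    using B cont by (simp add: homeomorphic_maps_def matrix_vector_mul_assoc)
  then have "homeomorphic_maps ?P ?P (\<lambda>(x, v). (id x, A *v v)) (\<lambda>(x, v). (id x, B *v v))"
    unfolding homeomorphic_maps_prod by (auto simp: homeomorphic_maps_def)
  then have 1: "homeomorphic_map ?P ?P (\<lambda>(x, v). (id x, A *v v))"
    unfolding homeomorphic_map_maps by blast
  have "(\<lambda>(x, v). \<phi> (x, A *v v)) = \<phi> \<circ> (\<lambda>(x, v). (id x, A *v v))" by auto
  with homeomorphic_map_compose[OF 1] \<phi> frame_at_matrix[OF _ A] show ?thesis
    by (fastforce simp: local_trivialization_def)
qed

text \<open>Here \<open>undefined\<close> is just some fixed index; it exists because \<open>CARD('d) \<ge> 1\<close>.\<close>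

definition sign_matrix :: "real \<Rightarrow> real^'d^'d" where
  "sign_matrix s = (\<chi> i j. if i = j then (if i = undefined then s else 1) else 0)"

lemma det_sign_matrix [simp]: "det (sign_matrix s) = s"
proof -
  have "det (sign_matrix s :: real^'d^'d) = (\<Prod>i\<in>UNIV. if i = (undefined :: 'd) then s else 1)"
    by (subst det_diagonal) (auto simp: sign_matrix_def)
  then show ?thesis by simp
qed

section \<open>Orientability in terms of the signs of frame changes\<close>

lemma orientable_bundle_iff_sign_coboundary:
  fixes \<phi> :: "'i \<Rightarrow> 'b \<times> (real^'d) \<Rightarrow> 'e"
  assumes triv: "\<And>i. i \<in> I \<Longrightarrow> local_trivialization \<xi> (V i) (\<phi> i)"
    and cover: "(\<Union>i\<in>I. V i) = topspace (base_space \<xi>)"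
  shows "orientable_bundle TYPE('d) \<xi> \<longleftrightarrow>
    (\<exists>\<nu> :: 'i \<Rightarrow> 'b \<Rightarrow> real.
      (\<forall>i\<in>I. locally_constant_on (base_space \<xi>) (V i) (\<nu> i) \<and> \<nu> i ` V i \<subseteq> {-1, 1}) \<and>
      (\<forall>i\<in>I. \<forall>j\<in>I. \<forall>x\<in>V i \<inter> V j.
         frame_sign (\<lambda>v. \<phi> i (x, v)) (\<lambda>v. \<phi> j (x, v)) = \<nu> j x * \<nu> i x))"
    (is "?L \<longleftrightarrow> ?R")
proof
  note frame = local_trivialization_frame[OF triv]
  assume ?L
  then obtain \<O> :: "'b \<Rightarrow> (real^'d \<Rightarrow> 'e) set" where
    \<O>: "\<And>x. x \<in> topspace (base_space \<xi>) \<Longrightarrow> fibre_orientation \<xi> x (\<O> x)" and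
    loc: "\<And>x. x \<in> topspace (base_space \<xi>) \<Longrightarrow> \<exists>V \<phi>. x \<in> V \<and> local_trivialization \<xi> V \<phi> \<and>
            (\<forall>y\<in>V. (\<lambda>v. \<phi> (y, v)) \<in> \<O> y)"
    unfolding orientable_bundle_def by metis
  define \<nu> where "\<nu> i x = (if (\<lambda>v. \<phi> i (x, v)) \<in> \<O> x then 1 else -1 :: real)" for i x
  \<comment> \<open>A reference frame \<open>f\<close> of the orientation decides membership: a
    frame lies in \<open>\<O> x\<close> iff its sign relative to \<open>f\<close> is 1. The cocycle
    identity through \<open>f\<close> then gives the product.\<close>
  have sign: "frame_sign g h = (if g \<in> \<O> x then 1 else -1) * (if h \<in> \<O> x then 1 else -1)"
    if x: "x \<in> topspace (base_space \<xi>)" and g: "frame_at \<xi> x g" and h: "frame_at \<xi> x h" for x g h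
  proof -
    obtain f where f: "frame_at \<xi> x f" and \<O>f: "\<O> x = {g. frame_at \<xi> x g \<and> frame_sign f g = 1}"
      using \<O>[OF x] by (auto simp: fibre_orientation_def frame_change_pos_iff)
    have "frame_sign f g * frame_sign g h = frame_sign f h" by (rule frame_sign_trans[OF f g h])
    then show ?thesis
      using frame_sign_cases[OF f g] frame_sign_cases[OF f h] g h by (auto simp: \<O>f)
  qed
  have "locally_constant_on (base_space \<xi>) (V i) (\<nu> i)" if i: "i \<in> I" for i
    unfolding locally_constant_on_def
  proof
    fix x assume x: "x \<in> V i"
    then have xB: "x \<in> topspace (base_space \<xi>)" using cover i by blast
    then obtain W \<psi> where W: "x \<in> W" "local_trivialization \<xi> W \<psi>" "\<forall>y\<in>W. (\<lambda>v. \<psi> (y, v)) \<in> \<O> y"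
      using loc by meson
    \<comment> \<open>Near \<open>x\<close> the orientation is induced by the single trivialization
      \<psi>, so there \<open>\<nu> i\<close> is a comparison sign of two trivializations, which is
      known to be locally constant.\<close>
    have \<nu>: "\<nu> i y = frame_sign (\<lambda>v. \<phi> i (y, v)) (\<lambda>v. \<psi> (y, v))" if "y \<in> V i \<inter> W" for y
    proof -
      have "y \<in> topspace (base_space \<xi>)" using that i cover by blast
      from sign[OF this frame[OF i] local_trivialization_frame[OF W(2)]] that W(3) show ?thesis
        by (simp add: \<nu>_def)
    qed
    obtain N where N: "openin (base_space \<xi>) N" "x \<in> N" and eq: "\<forall>y\<in>N \<inter> (V i \<inter> W).
        frame_sign (\<lambda>v. \<phi> i (y, v)) (\<lambda>v. \<psi> (y, v)) = frame_sign (\<lambda>v. \<phi> i (x, v)) (\<lambda>v. \<psi> (x, v))"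
      using locally_constant_frame_sign[OF triv[OF i] W(2)] x W(1)
      unfolding locally_constant_on_def by (meson IntI)
    have "\<nu> i y = \<nu> i x" if "y \<in> N \<inter> W \<inter> V i" for y
      using \<nu>[of x] \<nu>[of y] x W(1) that eq by auto
    moreover have "openin (base_space \<xi>) (N \<inter> W)"
      using N W by (simp add: local_trivialization_def openin_Int)
    ultimately show "\<exists>W. openin (base_space \<xi>) W \<and> x \<in> W \<and> (\<forall>y\<in>W \<inter> V i. \<nu> i y = \<nu> i x)"
      using N(2) W(1) by blast
  qed
  moreover have "frame_sign (\<lambda>v. \<phi> i (x, v)) (\<lambda>v. \<phi> j (x, v)) = \<nu> j x * \<nu> i x"
    if "i \<in> I" "j \<in> I" "x \<in> V i \<inter> V j" for i j x
  proof -
    have "x \<in> topspace (base_space \<xi>)" using that cover by blast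
    from sign[OF this frame[OF that(1)] frame[OF that(2)]] that(3) show ?thesis by (simp add: \<nu>_def)
  qed
  ultimately show ?R by (intro exI[of _ \<nu>]) (auto simp: \<nu>_def)
next
  note frame = local_trivialization_frame[OF triv]
  assume ?R
  then obtain \<nu> :: "'i \<Rightarrow> 'b \<Rightarrow> real" where
    \<nu>: "\<forall>i\<in>I. locally_constant_on (base_space \<xi>) (V i) (\<nu> i) \<and> \<nu> i ` V i \<subseteq> {-1, 1}" and
    co: "\<forall>i\<in>I. \<forall>j\<in>I. \<forall>x\<in>V i \<inter> V j.
         frame_sign (\<lambda>v. \<phi> i (x, v)) (\<lambda>v. \<phi> j (x, v)) = \<nu> j x * \<nu> i x"
    by (elim exE conjE)
  have lc: "locally_constant_on (base_space \<xi>) (V i) (\<nu> i)" if "i \<in> I" for i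
    using \<nu> that by blast
  have pm: "\<nu> i x = -1 \<or> \<nu> i x = 1" if "i \<in> I" "x \<in> V i" for i x
    using \<nu> that by blast
  \<comment> \<open>Quantifying over all trivializations around \<open>x\<close> avoids the choice
    of an index. The coboundary relation makes the condition for one index equivalent to the
    condition for all of them.\<close>
  define \<O> where "\<O> x = {g. frame_at \<xi> x g \<and>
      (\<forall>i\<in>I. x \<in> V i \<longrightarrow> frame_sign (\<lambda>v. \<phi> i (x, v)) g = \<nu> i x)}" for x
  \<comment> \<open>The trivialization \<open>\<phi> i\<close> corrected by a matrix of determinant
    \<open>\<nu> i x\<close>, which makes it a positive frame at \<open>x\<close>.\<close>
  let ?f = "\<lambda>i x v. \<phi> i (x, sign_matrix (\<nu> i x) *v v)"
  have f: "frame_at \<xi> x (?f i x)" if "i \<in> I" "x \<in> V i" for i x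
    by (rule frame_at_matrix[OF frame[OF that]]) (use pm[OF that] in auto)
  have \<O>: "\<O> x = {g. frame_at \<xi> x g \<and> frame_sign (?f i x) g = 1}"
    if i: "i \<in> I" "x \<in> V i" for i x
  proof -
    have fi: "frame_sign (?f i x) (\<lambda>v. \<phi> i (x, v)) = \<nu> i x"
      by (subst frame_sign_matrix[OF frame[OF i]]) (use pm[OF i] in auto)
    have "frame_sign (?f i x) g = 1 \<longleftrightarrow> (\<forall>j\<in>I. x \<in> V j \<longrightarrow> frame_sign (\<lambda>v. \<phi> j (x, v)) g = \<nu> j x)"
      if g: "frame_at \<xi> x g" for g
    proof -
      have a: "frame_sign (?f i x) g = \<nu> i x * frame_sign (\<lambda>v. \<phi> i (x, v)) g"
        using frame_sign_trans[OF f[OF i] frame[OF i] g] fi by simp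
      have b: "frame_sign (\<lambda>v. \<phi> j (x, v)) g = \<nu> j x * \<nu> i x * frame_sign (\<lambda>v. \<phi> i (x, v)) g"
        if j: "j \<in> I" "x \<in> V j" for j
        using frame_sign_trans[OF frame[OF j] frame[OF i] g] co i j by (simp add: mult.commute)
      have \<nu>2: "\<nu> i x * \<nu> i x = 1" using pm[OF i] by auto
      show ?thesis
      proof
        assume "frame_sign (?f i x) g = 1"
        with a \<nu>2 have "frame_sign (\<lambda>v. \<phi> i (x, v)) g = \<nu> i x"
          using pm[OF i] by auto
        with b \<nu>2 show "\<forall>j\<in>I. x \<in> V j \<longrightarrow> frame_sign (\<lambda>v. \<phi> j (x, v)) g = \<nu> j x" by simp
      next
        assume "\<forall>j\<in>I. x \<in> V j \<longrightarrow> frame_sign (\<lambda>v. \<phi> j (x, v)) g = \<nu> j x"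
        then show "frame_sign (?f i x) g = 1" using a \<nu>2 i by simp
      qed
    qed
    then show ?thesis unfolding \<O>_def by auto
  qed
  show ?L
    unfolding orientable_bundle_def
  proof (intro exI[of _ \<O>] conjI ballI)
    fix x assume "x \<in> topspace (base_space \<xi>)"
    then obtain i where i: "i \<in> I" "x \<in> V i" using cover by blast
    show "fibre_orientation \<xi> x (\<O> x)"
      unfolding fibre_orientation_def frame_change_pos_iff
      by (intro exI[of _ "?f i x"] conjI f[OF i] \<O>[OF i])
    obtain N where N: "openin (base_space \<xi>) N" "x \<in> N" "\<forall>y\<in>N \<inter> V i. \<nu> i y = \<nu> i x"
      using lc[OF i(1)] i(2) unfolding locally_constant_on_def by blast
    have ope: "openin (base_space \<xi>) (N \<inter> V i)"
      using N(1) triv[OF i(1)] by (auto simp: local_trivialization_def)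
    \<comment> \<open>On this set \<open>\<nu> i\<close> has the constant value
      \<open>\<nu> i x\<close>, so one fixed matrix corrects all the frames and the result is still
      a local trivialization.\<close>
    have "local_trivialization \<xi> (N \<inter> V i) (\<lambda>(y, v). \<phi> i (y, sign_matrix (\<nu> i x) *v v))"
      by (rule local_trivialization_matrix[OF local_trivialization_restrict[OF triv[OF i(1)] ope]])
        (use pm[OF i] in auto)
    moreover have "?f i y \<in> \<O> y" if y: "y \<in> V i" for y
      unfolding \<O>[OF i(1) y] using f[OF i(1) y] frame_sign_self by auto
    then have "(\<lambda>v. (\<lambda>(y, v). \<phi> i (y, sign_matrix (\<nu> i x) *v v)) (y, v)) \<in> \<O> y"
      if y: "y \<in> N \<inter> V i" for y
    proof -
      have "\<nu> i y = \<nu> i x" "y \<in> V i" using y N(3) by blast+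
      then show ?thesis using \<open>\<And>y. y \<in> V i \<Longrightarrow> ?f i y \<in> \<O> y\<close>[of y] by simp
    qed
    ultimately show "\<exists>V \<phi>. x \<in> V \<and> local_trivialization \<xi> V \<phi> \<and> (\<forall>y\<in>V. (\<lambda>v. \<phi> (y, v)) \<in> \<O> y)"
      using N(2) i(2) by blast
  qed
qed

section \<open>The first Stiefel--Whitney class\<close>

lemma cech_relI:
  assumes "(U, c) \<in> cech_cocycles X" "(V, c') \<in> cech_cocycles X" "point_cover X W"
    "\<And>p. p \<in> topspace X \<Longrightarrow> W p \<subseteq> U p \<inter> V p"
    "\<And>p. p \<in> topspace X \<Longrightarrow> locally_constant_on X (W p) (n p)"
    "\<And>p q x. p \<in> topspace X \<Longrightarrow> q \<in> topspace X \<Longrightarrow> x \<in> W p \<inter> W q \<Longrightarrow>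
       c p q x - c' p q x = n q x - n p x"
  shows "((U, c), (V, c')) \<in> cech_rel X"
  unfolding cech_rel_def mem_Collect_eq case_prod_conv
  by (intro conjI assms(1,2) exI[of _ W] exI[of _ n] ballI assms(3-6))

text \<open>The witnessing cochain is zero for reflexivity, the negative for symmetry, and the sum
  on the intersection of both refinements for transitivity.\<close>

lemma equiv_cech_rel: "equiv (cech_cocycles X) (cech_rel X)"
proof (rule equivI)
  show "cech_rel X \<subseteq> cech_cocycles X \<times> cech_cocycles X" by (auto simp: cech_rel_def)
  show "refl_on (cech_cocycles X) (cech_rel X)"
  proof (rule refl_onI)
    fix a assume "a \<in> cech_cocycles X"
    moreover from this have "fst a p \<subseteq> topspace X" if "p \<in> topspace X" for p
      using that openin_subset by (fastforce simp: cech_cocycles_def point_cover_def)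
    ultimately show "(a, a) \<in> cech_rel X"
      unfolding cech_rel_def
      by (auto simp: cech_cocycles_def
          intro!: exI[of _ "fst a"] exI[of _ "\<lambda>p x. 0"] locally_constant_on_const)
  qed
  show "sym (cech_rel X)"
  proof (rule symI)
    fix a b assume "(a, b) \<in> cech_rel X"
    then obtain U c V c' W n where ab: "a = (U, c)" "b = (V, c')" "a \<in> cech_cocycles X" "b \<in> cech_cocycles X"
      and W: "point_cover X W" "\<forall>p\<in>topspace X. W p \<subseteq> U p \<inter> V p"
      and n: "\<forall>p\<in>topspace X. locally_constant_on X (W p) (n p)"
        "\<forall>p\<in>topspace X. \<forall>q\<in>topspace X. \<forall>x\<in>W p \<inter> W q. c p q x - c' p q x = n q x - n p x"
      unfolding cech_rel_def by auto
    have "\<forall>p\<in>topspace X. \<forall>q\<in>topspace X. \<forall>x\<in>W p \<inter> W q. c' p q x - c p q x = - n q x - - n p x"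
      using n(2) by (metis minus_diff_eq minus_diff_minus)
    moreover have "\<forall>p\<in>topspace X. locally_constant_on X (W p) (\<lambda>x. - n p x)"
      using n(1) locally_constant_on_compose by blast
    moreover have "\<forall>p\<in>topspace X. W p \<subseteq> V p \<inter> U p" using W(2) by blast
    ultimately show "(b, a) \<in> cech_rel X"
      unfolding cech_rel_def using ab W(1) by fast
  qed
  show "trans (cech_rel X)"
  proof (rule transI)
    fix a b d assume "(a, b) \<in> cech_rel X" "(b, d) \<in> cech_rel X"
    then obtain U c V c' T c'' W n W' n' where
      ab: "a = (U, c)" "b = (V, c')" "d = (T, c'')" "a \<in> cech_cocycles X" "d \<in> cech_cocycles X"
      and W: "point_cover X W" "\<forall>p\<in>topspace X. W p \<subseteq> U p \<inter> V p"
      and n: "\<forall>p\<in>topspace X. locally_constant_on X (W p) (n p)"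
        "\<forall>p\<in>topspace X. \<forall>q\<in>topspace X. \<forall>x\<in>W p \<inter> W q. c p q x - c' p q x = n q x - n p x"
      and W': "point_cover X W'" "\<forall>p\<in>topspace X. W' p \<subseteq> V p \<inter> T p"
      and n': "\<forall>p\<in>topspace X. locally_constant_on X (W' p) (n' p)"
        "\<forall>p\<in>topspace X. \<forall>q\<in>topspace X. \<forall>x\<in>W' p \<inter> W' q. c' p q x - c'' p q x = n' q x - n' p x"
      unfolding cech_rel_def by auto
    have "\<forall>p\<in>topspace X. locally_constant_on X (W p \<inter> W' p) (\<lambda>x. n p x + n' p x)"
      using n(1) n'(1) by (auto intro: locally_constant_on_combine locally_constant_on_subset)
    moreover have "\<forall>p\<in>topspace X. \<forall>q\<in>topspace X. \<forall>x\<in>(W p \<inter> W' p) \<inter> (W q \<inter> W' q).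
        c p q x - c'' p q x = (n q x + n' q x) - (n p x + n' p x)"
    proof (intro ballI)
      fix p q x assume "p \<in> topspace X" "q \<in> topspace X" "x \<in> (W p \<inter> W' p) \<inter> (W q \<inter> W' q)"
      then have "c p q x - c' p q x = n q x - n p x" "c' p q x - c'' p q x = n' q x - n' p x"
        using n(2) n'(2) by auto
      then show "c p q x - c'' p q x = (n q x + n' q x) - (n p x + n' p x)"
        by (simp add: algebra_simps)
    qed
    moreover have "point_cover X (\<lambda>p. W p \<inter> W' p)"
      using W(1) W'(1) by (auto simp: point_cover_def)
    moreover have "\<forall>p\<in>topspace X. W p \<inter> W' p \<subseteq> U p \<inter> T p" using W(2) W'(2) by blast
    ultimately show "(a, d) \<in> cech_rel X"
      unfolding ab(1,3)
      by (intro cech_relI[where n = "\<lambda>p x. n p x + n' p x", OF ab(4)[unfolded ab(1)] ab(5)[unfolded ab(3)]]) blast+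
  qed
qed

section \<open>The sign cocycle of a system of trivializations and its class\<close>

definition sw_cocycle :: "('b \<Rightarrow> 'b \<times> (real^'d) \<Rightarrow> 'e) \<Rightarrow> 'b \<Rightarrow> 'b \<Rightarrow> 'b \<Rightarrow> bit" where
  "sw_cocycle \<phi> = (\<lambda>p q x. if det (frame_change (\<lambda>v. \<phi> p (x, v)) (\<lambda>v. \<phi> q (x, v))) < 0 then 1 else 0)"

text \<open>The passage from multiplicative signs to the additive group of integers modulo 2; on
  nonzero reals it is a homomorphism.\<close>

definition sign_bit :: "real \<Rightarrow> bit" where
  "sign_bit s = (if s < 0 then 1 else 0)"

lemma sign_bit_mult: "s \<noteq> 0 \<Longrightarrow> t \<noteq> 0 \<Longrightarrow> sign_bit (s * t) = sign_bit s + sign_bit t"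
  by (auto simp: sign_bit_def mult_less_0_iff)

lemma sw_cocycle_sign: "sw_cocycle \<phi> p q x = sign_bit (frame_sign (\<lambda>v. \<phi> p (x, v)) (\<lambda>v. \<phi> q (x, v)))"
  by (simp add: sw_cocycle_def sign_bit_def frame_sign_def)

lemma sign_bit_frame_sign_trans:
  assumes "frame_at \<xi> x f" "frame_at \<xi> x g" "frame_at \<xi> x h"
  shows "sign_bit (frame_sign f g) + sign_bit (frame_sign g h) = sign_bit (frame_sign f h)"
  using frame_sign_trans[OF assms] sign_bit_mult frame_sign_cases[OF assms(1,2)] frame_sign_cases[OF assms(2,3)]
  by (metis zero_neq_neg_one zero_neq_one)

definition trivialization_system ::
    "('e, 'b) vbundle \<Rightarrow> ('b \<Rightarrow> 'b set) \<Rightarrow> ('b \<Rightarrow> 'b \<times> (real^'d) \<Rightarrow> 'e) \<Rightarrow> bool" where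
  "trivialization_system \<xi> U \<phi> \<longleftrightarrow>
     (\<forall>p\<in>topspace (base_space \<xi>). p \<in> U p \<and> local_trivialization \<xi> (U p) (\<phi> p))"

lemma trivialization_system_point_cover:
  "trivialization_system \<xi> U \<phi> \<Longrightarrow> point_cover (base_space \<xi>) U"
  by (auto simp: trivialization_system_def point_cover_def local_trivialization_def)

lemma sw_cocycle_in_cech_cocycles:
  assumes "trivialization_system \<xi> U \<phi>"
  shows "(U, sw_cocycle \<phi>) \<in> cech_cocycles (base_space \<xi>)"
proof -
  have triv: "local_trivialization \<xi> (U p) (\<phi> p)" if "p \<in> topspace (base_space \<xi>)" for p
    using assms that by (simp add: trivialization_system_def)
  note frame = local_trivialization_frame[OF triv]
  have "locally_constant_on (base_space \<xi>) (U p \<inter> U q) (sw_cocycle \<phi> p q)"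
    if "p \<in> topspace (base_space \<xi>)" "q \<in> topspace (base_space \<xi>)" for p q
    unfolding sw_cocycle_sign
    by (rule locally_constant_on_compose[OF locally_constant_frame_sign[OF triv triv]]) fact+
  moreover have "sw_cocycle \<phi> p q x + sw_cocycle \<phi> q r x = sw_cocycle \<phi> p r x"
    if "p \<in> topspace (base_space \<xi>)" "q \<in> topspace (base_space \<xi>)" "r \<in> topspace (base_space \<xi>)"
      "x \<in> U p \<inter> U q \<inter> U r" for p q r x
    unfolding sw_cocycle_sign
    by (rule sign_bit_frame_sign_trans[of \<xi> x]) (use that frame in auto)
  ultimately show ?thesis
    using trivialization_system_point_cover[OF assms] by (auto simp: cech_cocycles_def)
qed

text \<open>Comparing the two trivializations with the same index \<open>p\<close> gives a cochain
  on \<open>U p \<inter> V p\<close> whose coboundary is the difference of the cocycles. Hence the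
  class in \<open>stiefel_whitney_1\<close> does not depend on the system chosen.\<close>

lemma sw_cocycle_unique:
  fixes \<phi> \<psi> :: "'b \<Rightarrow> 'b \<times> (real^'d) \<Rightarrow> 'e"
  assumes \<phi>: "trivialization_system \<xi> U \<phi>" and \<psi>: "trivialization_system \<xi> V \<psi>"
  shows "((U, sw_cocycle \<phi>), (V, sw_cocycle \<psi>)) \<in> cech_rel (base_space \<xi>)"
proof -
  have triv: "local_trivialization \<xi> (U p) (\<phi> p)" "local_trivialization \<xi> (V p) (\<psi> p)"
    if "p \<in> topspace (base_space \<xi>)" for p
    using \<phi> \<psi> that by (auto simp: trivialization_system_def)
  let ?n = "\<lambda>p x. sign_bit (frame_sign (\<lambda>v. \<phi> p (x, v)) (\<lambda>v. \<psi> p (x, v)))"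
  have "point_cover (base_space \<xi>) (\<lambda>p. U p \<inter> V p)"
    using \<phi>[THEN trivialization_system_point_cover] \<psi>[THEN trivialization_system_point_cover]
    by (auto simp: point_cover_def)
  moreover have "locally_constant_on (base_space \<xi>) (U p \<inter> V p) (?n p)"
    if "p \<in> topspace (base_space \<xi>)" for p
    by (rule locally_constant_on_compose[OF locally_constant_frame_sign[OF triv[OF that]]])
  moreover have "sw_cocycle \<phi> p q x - sw_cocycle \<psi> p q x = ?n q x - ?n p x"
    if pq: "p \<in> topspace (base_space \<xi>)" "q \<in> topspace (base_space \<xi>)"
      and x: "x \<in> (U p \<inter> V p) \<inter> (U q \<inter> V q)" for p q x
  proof -
    have fr: "frame_at \<xi> x (\<lambda>v. \<phi> p (x, v))" "frame_at \<xi> x (\<lambda>v. \<phi> q (x, v))"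
      "frame_at \<xi> x (\<lambda>v. \<psi> p (x, v))" "frame_at \<xi> x (\<lambda>v. \<psi> q (x, v))"
      using local_trivialization_frame[OF triv(1)[OF pq(1)]] local_trivialization_frame[OF triv(1)[OF pq(2)]]
        local_trivialization_frame[OF triv(2)[OF pq(1)]] local_trivialization_frame[OF triv(2)[OF pq(2)]] x
      by auto
    \<comment> \<open>Both sides compare the frame of \<open>\<phi> p\<close> with that of
      \<open>\<psi> q\<close>, once through \<open>\<phi> q\<close> and once through
      \<open>\<psi> p\<close>. Modulo 2, subtraction is addition, so this rearranges to the
      claim.\<close>
    have "sw_cocycle \<phi> p q x + ?n q x = ?n p x + sw_cocycle \<psi> p q x"
      unfolding sw_cocycle_sign
      using sign_bit_frame_sign_trans[OF fr(1,2,4)] sign_bit_frame_sign_trans[OF fr(1,3,4)] by simp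
    then show ?thesis
      by (cases "sw_cocycle \<phi> p q x"; cases "sw_cocycle \<psi> p q x"; cases "?n p x"; cases "?n q x") auto
  qed
  ultimately show ?thesis
    by (intro cech_relI[where n = ?n, OF sw_cocycle_in_cech_cocycles[OF \<phi>] sw_cocycle_in_cech_cocycles[OF \<psi>]])
      blast+
qed

lemma stiefel_whitney_1_eq:
  fixes \<phi> :: "'b \<Rightarrow> 'b \<times> (real^'d) \<Rightarrow> 'e"
  assumes "trivialization_system \<xi> U \<phi>"
  shows "stiefel_whitney_1 TYPE('d) \<xi> = cech_rel (base_space \<xi>) `` {(U, sw_cocycle \<phi>)}"
  unfolding stiefel_whitney_1_def sw_cocycle_def[symmetric] trivialization_system_def[symmetric]
  by (rule the_equality) (use assms sw_cocycle_unique equiv_class_eq[OF equiv_cech_rel] in blast)+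

text \<open>The class is zero iff, on some refinement, the cocycle is the coboundary of a cochain
  \<open>n\<close>. Such cochains correspond to the signs \<nu> of the orientability criterion, with
  0 read as 1 and 1 as -1.\<close>

lemma stiefel_whitney_1_trivial_iff_orientable:
  fixes \<phi> :: "'b \<Rightarrow> 'b \<times> (real^'d) \<Rightarrow> 'e"
  assumes sys: "trivialization_system \<xi> U \<phi>"
  shows "stiefel_whitney_1 TYPE('d) \<xi> = \<one>\<^bsub>cech_H1 (base_space \<xi>)\<^esub> \<longleftrightarrow> orientable_bundle TYPE('d) \<xi>"
proof -
  let ?X = "base_space \<xi>"
  have triv: "local_trivialization \<xi> (U p) (\<phi> p)" if "p \<in> topspace ?X" for p
    using sys that by (simp add: trivialization_system_def)
  note frame = local_trivialization_frame[OF triv]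
  have zero: "(\<lambda>p. topspace ?X, \<lambda>p q x. 0 :: bit) \<in> cech_cocycles ?X"
    by (auto simp: cech_cocycles_def point_cover_def intro: locally_constant_on_const)
  have "stiefel_whitney_1 TYPE('d) \<xi> = \<one>\<^bsub>cech_H1 ?X\<^esub> \<longleftrightarrow>
      ((U, sw_cocycle \<phi>), (\<lambda>p. topspace ?X, \<lambda>p q x. 0)) \<in> cech_rel ?X"
    using eq_equiv_class_iff[OF equiv_cech_rel sw_cocycle_in_cech_cocycles[OF sys] zero]
    by (simp add: stiefel_whitney_1_eq[OF sys] cech_H1_def)
  also have "\<dots> \<longleftrightarrow> orientable_bundle TYPE('d) \<xi>"
  proof
    assume "((U, sw_cocycle \<phi>), (\<lambda>p. topspace ?X, \<lambda>p q x. 0)) \<in> cech_rel ?X"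
    then obtain W n where W: "point_cover ?X W" "\<forall>p\<in>topspace ?X. W p \<subseteq> U p \<inter> topspace ?X"
      and lc: "\<forall>p\<in>topspace ?X. locally_constant_on ?X (W p) (n p)"
      and co: "\<forall>p\<in>topspace ?X. \<forall>q\<in>topspace ?X. \<forall>x\<in>W p \<inter> W q. sw_cocycle \<phi> p q x - 0 = n q x - n p x"
      unfolding cech_rel_def mem_Collect_eq case_prod_conv by blast
    have n: "sw_cocycle \<phi> p q x = n q x - n p x"
      if "p \<in> topspace ?X" "q \<in> topspace ?X" "x \<in> W p \<inter> W q" for p q x
      using co that by (metis diff_zero)
    \<comment> \<open>The cochain lives only on the refinement \<open>W\<close>, so the criterion is
      applied to the trivializations restricted to it.\<close>
    have trivW: "local_trivialization \<xi> (W p) (\<phi> p)" if "p \<in> topspace ?X" for p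
      by (rule local_trivialization_restrict[OF triv[OF that]]) (use W that in \<open>auto simp: point_cover_def\<close>)
    have cover: "(\<Union>p\<in>topspace ?X. W p) = topspace ?X"
      using W(1) openin_subset by (fastforce simp: point_cover_def)
    show "orientable_bundle TYPE('d) \<xi>"
    proof (subst orientable_bundle_iff_sign_coboundary[OF trivW cover], simp,
        intro exI[of _ "\<lambda>p x. if n p x = 0 then 1 else -1"] conjI ballI)
      fix p assume "p \<in> topspace ?X"
      then show "locally_constant_on ?X (W p) (\<lambda>x. if n p x = 0 then 1 else -1 :: real)"
        using locally_constant_on_compose[OF lc[rule_format], of p "\<lambda>b. if b = 0 then 1 else -1"] by simp
      show "(\<lambda>x. if n p x = 0 then 1 else -1) ` W p \<subseteq> {-1, 1 :: real}" by auto
    next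
      fix p q x assume pq: "p \<in> topspace ?X" "q \<in> topspace ?X" and x: "x \<in> W p \<inter> W q"
      have "frame_sign (\<lambda>v. \<phi> p (x, v)) (\<lambda>v. \<phi> q (x, v)) \<in> {1, -1}"
        using frame_sign_cases[OF local_trivialization_frame[OF trivW[OF pq(1)]]
            local_trivialization_frame[OF trivW[OF pq(2)]]] x by auto
      then show "frame_sign (\<lambda>v. \<phi> p (x, v)) (\<lambda>v. \<phi> q (x, v)) =
          (if n q x = 0 then 1 else -1) * (if n p x = 0 then 1 else -1)"
        using n[OF pq x] by (cases "n p x"; cases "n q x") (auto simp: sw_cocycle_sign sign_bit_def)
    qed
  next
    assume ori: "orientable_bundle TYPE('d) \<xi>"
    have cover: "(\<Union>p\<in>topspace ?X. U p) = topspace ?X"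
      using trivialization_system_point_cover[OF sys] openin_subset by (fastforce simp: point_cover_def)
    obtain \<nu> :: "'b \<Rightarrow> 'b \<Rightarrow> real" where
      \<nu>: "\<forall>p\<in>topspace ?X. locally_constant_on ?X (U p) (\<nu> p) \<and> \<nu> p ` U p \<subseteq> {-1, 1}" and
      co: "\<forall>p\<in>topspace ?X. \<forall>q\<in>topspace ?X. \<forall>x\<in>U p \<inter> U q.
         frame_sign (\<lambda>v. \<phi> p (x, v)) (\<lambda>v. \<phi> q (x, v)) = \<nu> q x * \<nu> p x"
      using ori unfolding orientable_bundle_iff_sign_coboundary[where \<phi> = \<phi>, OF triv cover, simplified]
      by (elim exE conjE)
    have pm: "\<nu> p x = -1 \<or> \<nu> p x = 1" if "p \<in> topspace ?X" "x \<in> U p" for p x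
      using \<nu> that by blast
    let ?n = "\<lambda>p x. sign_bit (\<nu> p x)"
    have "sw_cocycle \<phi> p q x - 0 = ?n q x - ?n p x"
      if "p \<in> topspace ?X" "q \<in> topspace ?X" "x \<in> U p \<inter> U q" for p q x
      using pm[OF that(1), of x] pm[OF that(2), of x] that(3)
      by (auto simp: sw_cocycle_sign co that sign_bit_def)
    moreover have "\<forall>p\<in>topspace ?X. locally_constant_on ?X (U p) (?n p)"
      using \<nu> by (auto intro: locally_constant_on_compose)
    \<comment> \<open>In this direction the original cover itself serves as the common
      refinement.\<close>
    moreover have "\<forall>p\<in>topspace ?X. U p \<subseteq> U p \<inter> topspace ?X" using cover by blast
    ultimately show "((U, sw_cocycle \<phi>), (\<lambda>p. topspace ?X, \<lambda>p q x. 0)) \<in> cech_rel ?X"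
      by (intro cech_relI[where n = ?n, OF sw_cocycle_in_cech_cocycles[OF sys] zero
            trivialization_system_point_cover[OF sys]]) blast+
  qed
  finally show ?thesis .
qed

section \<open>Smooth maps and Jacobians of chart transitions\<close>

lemma continuous_on_locally:
  fixes f :: "'a::t2_space \<Rightarrow> 'b::topological_space"
  assumes "\<And>x. x \<in> S \<Longrightarrow> \<exists>N. open N \<and> x \<in> N \<and> continuous_on (S \<inter> N) f"
  shows "continuous_on S f"
  unfolding continuous_on_eq_continuous_within
proof
  fix x assume x: "x \<in> S"
  then obtain N where N: "open N" "x \<in> N" "continuous_on (S \<inter> N) f" using assms by blast
  then have "continuous (at x within S \<inter> N) f"
    using x by (simp add: continuous_on_eq_continuous_within)
  moreover have "at x within S \<inter> N = at x within S"
    by (rule at_within_nhd[OF N(2,1)]) blast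
  ultimately show "continuous (at x within S) f" by simp
qed

lemma smooth_map_on_imp_continuous_on:
  assumes "smooth_map_on S f" shows "continuous_on S f"
proof (rule continuous_on_locally)
  fix x assume "x \<in> S"
  then obtain W F where W: "open W" "x \<in> W" "\<forall>k. cont_diff_on k F W" "\<forall>y\<in>S \<inter> W. F y = f y"
    using assms unfolding smooth_map_on_def by meson
  have "cont_diff_on 0 F W" using W(3) by blast
  then have "continuous_on (S \<inter> W) F" by (auto intro: continuous_on_subset)
  then have "continuous_on (S \<inter> W) f" using W(4) by (metis continuous_on_cong)
  with W show "\<exists>N. open N \<and> x \<in> N \<and> continuous_on (S \<inter> N) f" by blast
qed

lemma cont_diff_on_SucD:
  assumes "\<forall>k. cont_diff_on k F W"
  shows "x \<in> W \<Longrightarrow> (F has_derivative frechet_derivative F (at x)) (at x)"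
    and "continuous_on W (\<lambda>x. frechet_derivative F (at x) v)"
    and "continuous_on W F"
proof -
  have "cont_diff_on (Suc 0) F W" "cont_diff_on 0 F W" using assms by blast+
  then show "x \<in> W \<Longrightarrow> (F has_derivative frechet_derivative F (at x)) (at x)"
    "continuous_on W (\<lambda>x. frechet_derivative F (at x) v)" "continuous_on W F"
    by (auto simp: frechet_derivative_works)
qed

text \<open>On an open set the derivatives at a point are determined by the values in the set. This
  permits replacing the \<open>frechet_derivative\<close> in the recursion by an explicit
  formula.\<close>

lemma cont_diff_on_cong:
  assumes S: "open S" shows "(\<And>x. x \<in> S \<Longrightarrow> f x = g x) \<Longrightarrow> cont_diff_on k f S \<Longrightarrow> cont_diff_on k g S"
proof (induction k arbitrary: f g)
  case 0
  then show ?case by (simp cong: continuous_on_cong)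
next
  case (Suc k)
  have d: "f differentiable at x" if "x \<in> S" for x using Suc.prems(2) that by simp
  have "g differentiable at x" if x: "x \<in> S" for x
  proof -
    obtain f' where "(f has_derivative f') (at x)" using d[OF x] unfolding differentiable_def by blast
    then have "(g has_derivative f') (at x)"
      by (rule has_derivative_transform_within_open[OF _ S x]) (rule Suc.prems(1))
    then show ?thesis unfolding differentiable_def by blast
  qed
  moreover have "cont_diff_on k (\<lambda>x. frechet_derivative g (at x) v) S" for v
  proof (rule Suc.IH)
    show "frechet_derivative f (at x) v = frechet_derivative g (at x) v" if "x \<in> S" for x
      using frechet_derivative_transform_within_open[OF d[OF that] S that Suc.prems(1)] by simp
    show "cont_diff_on k (\<lambda>x. frechet_derivative f (at x) v) S" using Suc.prems(2) by simp
  qed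
  ultimately show ?case by simp
qed

text \<open>A directional derivative of \<open>L\<close> after \<open>f\<close> is again
  \<open>L\<close> after a directional derivative of \<open>f\<close>, so the induction goes through
  for all \<open>f\<close> at once.\<close>

lemma cont_diff_on_linear_left:
  assumes L: "bounded_linear L" and S: "open S"
  shows "cont_diff_on k f S \<Longrightarrow> cont_diff_on k (\<lambda>x. L (f x)) S"
proof (induction k arbitrary: f)
  case 0
  then show ?case using bounded_linear.continuous_on[OF L] by simp
next
  case (Suc k)
  have d: "((\<lambda>x. L (f x)) has_derivative (\<lambda>v. L (frechet_derivative f (at x) v))) (at x)" if "x \<in> S" for x
    by (rule bounded_linear.has_derivative[OF L]) (use Suc.prems that in \<open>simp add: frechet_derivative_works\<close>)
  have "cont_diff_on k (\<lambda>x. L (frechet_derivative f (at x) v)) S" for v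
    using Suc by simp
  then have "cont_diff_on k (\<lambda>x. frechet_derivative (\<lambda>x. L (f x)) (at x) v) S" for v
    by (rule cont_diff_on_cong[OF S, rotated]) (simp add: frechet_derivative_at[OF d, symmetric])
  then show ?case using d by (auto simp: differentiable_def)
qed

text \<open>The derivative of the composite in direction \<open>v\<close> is the derivative of
  \<open>f\<close> in direction \<open>L v\<close>, precomposed with \<open>L\<close>; this has the
  form required by the induction.\<close>

lemma cont_diff_on_linear_right:
  assumes L: "bounded_linear L" and S: "open S"
  shows "cont_diff_on k f S \<Longrightarrow> cont_diff_on k (\<lambda>x. f (L x)) (L -` S)"
proof (induction k arbitrary: f)
  case 0
  then show ?case
    using continuous_on_compose2[OF _ bounded_linear.continuous_on[OF L continuous_on_id], of S f "L -` S"]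
    by auto
next
  case (Suc k)
  have o: "open (L -` S)"
    using S L by (simp add: bounded_linear.linear linear_continuous_on open_vimage)
  have d: "((\<lambda>x. f (L x)) has_derivative (\<lambda>v. frechet_derivative f (at (L x)) (L v))) (at x)"
    if "x \<in> L -` S" for x
  proof -
    have "(f has_derivative frechet_derivative f (at (L x))) (at (L x))"
      using Suc.prems that by (simp add: frechet_derivative_works)
    from diff_chain_at[OF bounded_linear_imp_has_derivative[OF L] this] show ?thesis by (simp add: o_def)
  qed
  have "cont_diff_on k (\<lambda>x. frechet_derivative f (at (L x)) (L v)) (L -` S)" for v
    using Suc.IH[of "\<lambda>y. frechet_derivative f (at y) (L v)"] Suc.prems by simp
  then have "cont_diff_on k (\<lambda>x. frechet_derivative (\<lambda>x. f (L x)) (at x) v) (L -` S)" for v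
    by (rule cont_diff_on_cong[OF o, rotated]) (simp add: frechet_derivative_at[OF d, symmetric])
  then show ?case using d by (auto simp: differentiable_def)
qed

section \<open>Manifold charts and the Jacobians of their transitions\<close>

definition chart_jacobian ::
    "(real^'n) set \<Rightarrow> (real^'n \<Rightarrow> real^'d) \<Rightarrow> (real^'n) set \<Rightarrow> (real^'n \<Rightarrow> real^'d) \<Rightarrow> real^'n \<Rightarrow> real^'d^'d" where
  "chart_jacobian V \<psi> V' \<psi>' x = jacobian (\<psi>' \<circ> inv_into V \<psi>) (at (\<psi> x) within \<psi> ` (V \<inter> V'))"

lemma manifold_chartD:
  assumes "manifold_chart M V \<psi>"
  shows "openin (top_of_set M) V" "open (\<psi> ` V)" "inj_on \<psi> V" "smooth_map_on V \<psi>"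
    "smooth_map_on (\<psi> ` V) (inv_into V \<psi>)" "V \<subseteq> M"
  using assms openin_imp_subset unfolding manifold_chart_def diffeomorphism_on_def bij_betw_def by auto

lemma manifold_chart_inv: "manifold_chart M V \<psi> \<Longrightarrow> x \<in> V \<Longrightarrow> inv_into V \<psi> (\<psi> x) = x"
  by (simp add: manifold_chartD(3))

text \<open>The set \<open>W\<close> is cut out of \<open>M\<close> by an ambient open set
  \<open>T\<close>, and the image is the preimage of \<open>T\<close> under the continuous inverse
  chart on its open domain.\<close>

lemma manifold_chart_open_image:
  assumes \<psi>: "manifold_chart M V \<psi>" and W: "openin (top_of_set M) W"
  shows "open (\<psi> ` (V \<inter> W))"
proof -
  note ch = manifold_chartD[OF \<psi>]
  obtain T where T: "open T" "W = M \<inter> T" using W openin_open by blast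
  have "\<psi> ` (V \<inter> W) = \<psi> ` V \<inter> inv_into V \<psi> -` T"
    using ch(3,6) by (auto simp: T(2))
  then show ?thesis
    using continuous_open_preimage[OF smooth_map_on_imp_continuous_on[OF ch(5)] ch(2) T(1)] by simp
qed

text \<open>Smoothness is given by local extensions to ambient open sets. Near
  \<open>\<psi> x\<close> the transition is a composition of an extension \<open>F\<close> of the
  inverse chart and an extension \<open>G\<close> of \<psi>', so the chain rule provides the
  derivative and its continuity.\<close>

lemma chart_transition_C1:
  assumes \<psi>: "manifold_chart M V \<psi>" and \<psi>': "manifold_chart M V' \<psi>'" and x: "x \<in> V \<inter> V'"
  obtains N D where "open N" "\<psi> x \<in> N" "N \<subseteq> \<psi> ` (V \<inter> V')"
    "\<And>z. z \<in> N \<Longrightarrow> ((\<psi>' \<circ> inv_into V \<psi>) has_derivative D z) (at z)"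
    "\<And>v. continuous_on N (\<lambda>z. D z v)"
proof -
  note ch = manifold_chartD[OF \<psi>] and ch' = manifold_chartD[OF \<psi>']
  have "\<psi> x \<in> \<psi> ` V" using x by blast
  then obtain W1 F where W1: "open W1" "\<psi> x \<in> W1" "\<forall>k. cont_diff_on k F W1"
      "\<forall>y\<in>\<psi> ` V \<inter> W1. F y = inv_into V \<psi> y"
    using ch(5) unfolding smooth_map_on_def by meson
  have "x \<in> V'" using x by blast
  then obtain W2 G where W2: "open W2" "x \<in> W2" "\<forall>k. cont_diff_on k G W2" "\<forall>y\<in>V' \<inter> W2. G y = \<psi>' y"
    using ch'(4) unfolding smooth_map_on_def by meson
  \<comment> \<open>The points of the overlap at which both extensions agree with the maps that they
    extend.\<close>
  define N where "N = (W1 \<inter> \<psi> ` (V \<inter> V')) \<inter> F -` W2"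
  have F: "F (\<psi> y) = y" if "y \<in> V" "\<psi> y \<in> W1" for y
    using W1(4) that manifold_chart_inv[OF \<psi>] by auto
  have oV: "open (\<psi> ` (V \<inter> V'))" by (rule manifold_chart_open_image[OF \<psi> ch'(1)])
  have cF: "continuous_on (W1 \<inter> \<psi> ` (V \<inter> V')) F"
    using cont_diff_on_SucD(3)[OF W1(3)] by (rule continuous_on_subset) blast
  have oN: "open N"
    unfolding N_def by (rule continuous_open_preimage[OF cF _ W2(1)]) (use W1(1) oV in blast)
  have xN: "\<psi> x \<in> N" using x W1(2) W2(2) F[of x] by (auto simp: N_def)
  define D where "D z = (\<lambda>v. frechet_derivative G (at (F z)) (frechet_derivative F (at z) v))" for z
  have D: "((\<psi>' \<circ> inv_into V \<psi>) has_derivative D z) (at z)" if z: "z \<in> N" for z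
  proof (rule has_derivative_transform_within_open[OF _ oN z])
    have "z \<in> W1" "F z \<in> W2" using z by (auto simp: N_def)
    from diff_chain_at[OF cont_diff_on_SucD(1)[OF W1(3) this(1)] cont_diff_on_SucD(1)[OF W2(3) this(2)]]
    show "((G \<circ> F) has_derivative D z) (at z)" by (simp add: D_def o_def)
    show "(G \<circ> F) y = (\<psi>' \<circ> inv_into V \<psi>) y" if y: "y \<in> N" for y
    proof -
      obtain p where p: "p \<in> V" "p \<in> V'" "y = \<psi> p" "y \<in> W1" "F y \<in> W2"
        using y unfolding N_def by blast
      then show ?thesis using F[of p] W2(4) manifold_chart_inv[OF \<psi> p(1)] by auto
    qed
  qed
  have "continuous_on N (\<lambda>z. D z v)" for v
  proof -
    have lin: "linear (frechet_derivative G (at (F z)))" if "z \<in> N" for z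
      using cont_diff_on_SucD(1)[OF W2(3), of "F z"] that by (auto simp: N_def has_derivative_linear)
    \<comment> \<open>The derivative of \<open>G\<close> is known to be continuous in the base point
      only for each fixed direction, whereas here the direction also varies with \<open>z\<close>.
      Expanding it in the basis separates the two dependences.\<close>
    have eq: "D z v = (\<Sum>b\<in>Basis. (frechet_derivative F (at z) v \<bullet> b) *\<^sub>R frechet_derivative G (at (F z)) b)"
      if "z \<in> N" for z
    proof -
      have "D z v = frechet_derivative G (at (F z)) (\<Sum>b\<in>Basis. (frechet_derivative F (at z) v \<bullet> b) *\<^sub>R b)"
        by (simp add: D_def euclidean_representation)
      also have "\<dots> = (\<Sum>b\<in>Basis. (frechet_derivative F (at z) v \<bullet> b) *\<^sub>R frechet_derivative G (at (F z)) b)"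
        using lin[OF that] by (simp add: linear_sum linear_scale)
      finally show ?thesis .
    qed
    have 1: "continuous_on N (\<lambda>z. frechet_derivative F (at z) v)"
      using cont_diff_on_SucD(2)[OF W1(3)] by (rule continuous_on_subset) (auto simp: N_def)
    have 2: "continuous_on N (\<lambda>z. frechet_derivative G (at (F z)) b)" for b
      by (rule continuous_on_compose2[OF cont_diff_on_SucD(2)[OF W2(3)]
            continuous_on_subset[OF cont_diff_on_SucD(3)[OF W1(3)]]]) (auto simp: N_def)
    have "continuous_on N (\<lambda>z. \<Sum>b\<in>Basis. (frechet_derivative F (at z) v \<bullet> b) *\<^sub>R frechet_derivative G (at (F z)) b)"
      by (intro continuous_intros 1 2)
    then show ?thesis by (rule continuous_on_eq) (simp add: eq)
  qed
  moreover have "N \<subseteq> \<psi> ` (V \<inter> V')" by (auto simp: N_def)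
  ultimately show thesis using that oN xN D by blast
qed

lemma chart_jacobian_works:
  assumes \<psi>: "manifold_chart M V \<psi>" and \<psi>': "manifold_chart M V' \<psi>'" and x: "x \<in> V \<inter> V'"
  shows "((\<psi>' \<circ> inv_into V \<psi>) has_derivative (\<lambda>h. chart_jacobian V \<psi> V' \<psi>' x *v h)) (at (\<psi> x))"
proof -
  obtain N D where "\<psi> x \<in> N" and "\<And>z. z \<in> N \<Longrightarrow> ((\<psi>' \<circ> inv_into V \<psi>) has_derivative D z) (at z)"
    using chart_transition_C1[OF assms] by metis
  then have d: "(\<psi>' \<circ> inv_into V \<psi>) differentiable (at (\<psi> x))" unfolding differentiable_def by blast
  \<comment> \<open>The overlap has open image, so the derivative within it is the ordinary
    derivative.\<close>
  have "at (\<psi> x) within \<psi> ` (V \<inter> V') = at (\<psi> x)"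
    using x manifold_chart_open_image[OF \<psi> manifold_chartD(1)[OF \<psi>']] by (intro at_within_open) auto
  then show ?thesis using d unfolding chart_jacobian_def by (simp add: jacobian_works[symmetric])
qed

lemma chart_jacobian_eqI:
  assumes "manifold_chart M V \<psi>" "manifold_chart M V' \<psi>'" "x \<in> V \<inter> V'"
    and "((\<psi>' \<circ> inv_into V \<psi>) has_derivative ((*v) A)) (at (\<psi> x))"
  shows "chart_jacobian V \<psi> V' \<psi>' x = A"
  using has_derivative_unique[OF chart_jacobian_works[OF assms(1-3)] assms(4)]
  by (simp add: matrix_eq fun_eq_iff)

text \<open>The chain rule: on the image of \<open>V1 \<inter> V2\<close>, an open neighbourhood of
  \<open>\<psi>1 x\<close>, the transition from the first chart to the third factors through the
  second.\<close>

lemma chart_jacobian_trans: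
  assumes 1: "manifold_chart M V1 \<psi>1" and 2: "manifold_chart M V2 \<psi>2" and 3: "manifold_chart M V3 \<psi>3"
    and x: "x \<in> V1" "x \<in> V2" "x \<in> V3"
  shows "chart_jacobian V1 \<psi>1 V3 \<psi>3 x = chart_jacobian V2 \<psi>2 V3 \<psi>3 x ** chart_jacobian V1 \<psi>1 V2 \<psi>2 x"
proof (rule chart_jacobian_eqI[OF 1 3])
  have d1: "((\<psi>2 \<circ> inv_into V1 \<psi>1) has_derivative (\<lambda>h. chart_jacobian V1 \<psi>1 V2 \<psi>2 x *v h)) (at (\<psi>1 x))"
    using chart_jacobian_works[OF 1 2] x by blast
  have "((\<psi>3 \<circ> inv_into V2 \<psi>2) has_derivative (\<lambda>h. chart_jacobian V2 \<psi>2 V3 \<psi>3 x *v h)) (at (\<psi>2 x))"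
    using chart_jacobian_works[OF 2 3] x by blast
  then have d2: "((\<psi>3 \<circ> inv_into V2 \<psi>2) has_derivative (\<lambda>h. chart_jacobian V2 \<psi>2 V3 \<psi>3 x *v h))
      (at ((\<psi>2 \<circ> inv_into V1 \<psi>1) (\<psi>1 x)))"
    using manifold_chart_inv[OF 1 x(1)] by simp
  show "((\<psi>3 \<circ> inv_into V1 \<psi>1) has_derivative
      (*v) (chart_jacobian V2 \<psi>2 V3 \<psi>3 x ** chart_jacobian V1 \<psi>1 V2 \<psi>2 x)) (at (\<psi>1 x))"
  proof (rule has_derivative_transform_within_open)
    show "((\<psi>3 \<circ> inv_into V2 \<psi>2) \<circ> (\<psi>2 \<circ> inv_into V1 \<psi>1) has_derivative
        (*v) (chart_jacobian V2 \<psi>2 V3 \<psi>3 x ** chart_jacobian V1 \<psi>1 V2 \<psi>2 x)) (at (\<psi>1 x))"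
      using diff_chain_at[OF d1 d2] by (simp add: o_def matrix_vector_mul_assoc)
    show "open (\<psi>1 ` (V1 \<inter> V2))" by (rule manifold_chart_open_image[OF 1 manifold_chartD(1)[OF 2]])
    show "\<psi>1 x \<in> \<psi>1 ` (V1 \<inter> V2)" using x by blast
    show "((\<psi>3 \<circ> inv_into V2 \<psi>2) \<circ> (\<psi>2 \<circ> inv_into V1 \<psi>1)) y = (\<psi>3 \<circ> inv_into V1 \<psi>1) y"
      if "y \<in> \<psi>1 ` (V1 \<inter> V2)" for y
      using that manifold_chart_inv[OF 1] manifold_chart_inv[OF 2] by auto
  qed
qed (use x in blast)

lemma chart_jacobian_linear:
  assumes 1: "manifold_chart M V \<psi>" and 2: "manifold_chart M V (\<lambda>y. A *v \<psi> y)" and x: "x \<in> V"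
  shows "chart_jacobian V \<psi> V (\<lambda>y. A *v \<psi> y) x = A"
proof (rule chart_jacobian_eqI[OF 1 2])
  show "(((\<lambda>y. A *v \<psi> y) \<circ> inv_into V \<psi>) has_derivative (*v) A) (at (\<psi> x))"
  proof (rule has_derivative_transform_within_open)
    show "((*v) A has_derivative (*v) A) (at (\<psi> x))"
      by (simp add: bounded_linear_imp_has_derivative linear_linear)
    show "open (\<psi> ` V)" by (rule manifold_chartD(2)[OF 1])
    show "A *v y = ((\<lambda>y. A *v \<psi> y) \<circ> inv_into V \<psi>) y" if "y \<in> \<psi> ` V" for y
      using that by (simp add: f_inv_into_f)
  qed (use x in blast)
qed (use x in blast)

lemma chart_jacobian_self:
  "manifold_chart M V \<psi> \<Longrightarrow> x \<in> V \<Longrightarrow> chart_jacobian V \<psi> V \<psi> x = mat 1"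
  using chart_jacobian_linear[of M V \<psi> "mat 1" x] by simp

text \<open>Locally the entries are components of the continuous directional derivatives from
  \<open>chart_transition_C1\<close>, pulled back along the continuous chart \<psi>.\<close>

lemma continuous_on_chart_jacobian:
  assumes \<psi>: "manifold_chart M V \<psi>" and \<psi>': "manifold_chart M V' \<psi>'"
  shows "continuous_on (V \<inter> V') (\<lambda>x. chart_jacobian V \<psi> V' \<psi>' x $ i $ j)"
proof (rule continuous_on_locally)
  fix x assume x: "x \<in> V \<inter> V'"
  obtain N D where N: "open N" "\<psi> x \<in> N" "N \<subseteq> \<psi> ` (V \<inter> V')"
    "\<And>z. z \<in> N \<Longrightarrow> ((\<psi>' \<circ> inv_into V \<psi>) has_derivative D z) (at z)"
    "\<And>v. continuous_on N (\<lambda>z. D z v)"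
    using chart_transition_C1[OF \<psi> \<psi>' x] by metis
  have c\<psi>: "continuous_on (V \<inter> V') \<psi>"
    using smooth_map_on_imp_continuous_on[OF manifold_chartD(4)[OF \<psi>]] by (rule continuous_on_subset) blast
  then obtain T where T: "open T" "(V \<inter> V') \<inter> \<psi> -` N = (V \<inter> V') \<inter> T"
    using continuous_openin_preimage_gen[OF c\<psi> N(1)] unfolding openin_open by blast
  have eq: "chart_jacobian V \<psi> V' \<psi>' y $ i $ j = D (\<psi> y) (axis j 1) $ i" if y: "y \<in> V \<inter> V'" "y \<in> T" for y
  proof -
    have "\<psi> y \<in> N" using T(2) y by blast
    from has_derivative_unique[OF chart_jacobian_works[OF \<psi> \<psi>' y(1)] N(4)[OF this]]
    have "chart_jacobian V \<psi> V' \<psi>' y *v axis j 1 = D (\<psi> y) (axis j 1)" by metis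
    then show ?thesis by (metis column_def matrix_vector_mult_basis vec_lambda_beta)
  qed
  have "continuous_on (V \<inter> V' \<inter> T) (\<lambda>y. D (\<psi> y) (axis j 1) $ i)"
  proof (rule continuous_on_component, rule continuous_on_compose2[OF N(5)])
    show "continuous_on (V \<inter> V' \<inter> T) \<psi>" using c\<psi> by (rule continuous_on_subset) blast
    show "\<psi> ` (V \<inter> V' \<inter> T) \<subseteq> N" using T(2) by blast
  qed
  then have "continuous_on (V \<inter> V' \<inter> T) (\<lambda>y. chart_jacobian V \<psi> V' \<psi>' y $ i $ j)"
    by (rule continuous_on_eq) (use eq in auto)
  moreover have "x \<in> T" using T(2) x N(2) by blast
  ultimately show "\<exists>N. open N \<and> x \<in> N \<and> continuous_on (V \<inter> V' \<inter> N) (\<lambda>x. chart_jacobian V \<psi> V' \<psi>' x $ i $ j)"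
    using T(1) by blast
qed

lemma det_chart_jacobian_nonzero:
  assumes "manifold_chart M V \<psi>" "manifold_chart M V' \<psi>'" "x \<in> V" "x \<in> V'"
  shows "det (chart_jacobian V \<psi> V' \<psi>' x) \<noteq> 0"
  using chart_jacobian_trans[OF assms(1,2,1) assms(3,4,3)] chart_jacobian_self[OF assms(1,3)]
  by (metis det_I det_mul mult_zero_right zero_neq_one)

lemma locally_constant_chart_sign:
  assumes \<psi>: "manifold_chart M V \<psi>" and \<psi>': "manifold_chart M V' \<psi>'"
  shows "locally_constant_on (top_of_set M) (V \<inter> V') (\<lambda>x. sgn (det (chart_jacobian V \<psi> V' \<psi>' x)))"
proof (rule locally_constant_on_sgn)
  have "V \<inter> V' \<subseteq> M" using manifold_chartD(6)[OF \<psi>] by blast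
  moreover have "continuous_on (V \<inter> V') (\<lambda>x. det (chart_jacobian V \<psi> V' \<psi>' x))"
    unfolding det_def by (intro continuous_intros continuous_on_chart_jacobian[OF assms])
  ultimately show "continuous_map (subtopology (top_of_set M) (V \<inter> V')) euclideanreal
      (\<lambda>x. det (chart_jacobian V \<psi> V' \<psi>' x))"
    by (simp add: subtopology_subtopology Int_absorb1)
  show "openin (top_of_set M) (V \<inter> V')" using \<psi> \<psi>' by (simp add: manifold_chartD(1) openin_Int)
  show "det (chart_jacobian V \<psi> V' \<psi>' x) \<noteq> 0" if "x \<in> V \<inter> V'" for x
    using det_chart_jacobian_nonzero[OF assms] that by blast
qed

lemma sgn_chart_jacobian_trans:
  assumes "manifold_chart M V1 \<psi>1" "manifold_chart M V2 \<psi>2" "manifold_chart M V3 \<psi>3"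
    "x \<in> V1" "x \<in> V2" "x \<in> V3"
  shows "sgn (det (chart_jacobian V1 \<psi>1 V3 \<psi>3 x)) =
    sgn (det (chart_jacobian V1 \<psi>1 V2 \<psi>2 x)) * sgn (det (chart_jacobian V2 \<psi>2 V3 \<psi>3 x))"
  by (simp add: chart_jacobian_trans[OF assms] det_mul sgn_mult)

lemma sgn_chart_jacobian_cases:
  assumes "manifold_chart M V \<psi>" "manifold_chart M V' \<psi>'" "x \<in> V" "x \<in> V'"
  shows "sgn (det (chart_jacobian V \<psi> V' \<psi>' x)) \<in> {-1, 1}"
  using det_chart_jacobian_nonzero[OF assms] by (auto simp: sgn_real_def)

text \<open>The two Jacobians are mutually inverse, and a sign is its own inverse.\<close>

lemma sgn_chart_jacobian_sym:
  assumes "manifold_chart M V \<psi>" "manifold_chart M V' \<psi>'" "x \<in> V" "x \<in> V'"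
  shows "sgn (det (chart_jacobian V' \<psi>' V \<psi> x)) = sgn (det (chart_jacobian V \<psi> V' \<psi>' x))"
  using sgn_chart_jacobian_trans[OF assms(1,2,1) assms(3,4,3)] chart_jacobian_self[OF assms(1,3)]
    sgn_chart_jacobian_cases[OF assms] by auto

text \<open>With a matrix of negative determinant this reverses the orientation of a chart. The new
  inverse is the inverse matrix \<open>B\<close> followed by the old inverse chart, so linear
  composition on the left and on the right gives smoothness both ways.\<close>

lemma manifold_chart_linear:
  assumes \<psi>: "manifold_chart M V \<psi>" and A: "det (A :: real^'d^'d) \<noteq> 0"
  shows "manifold_chart M V (\<lambda>x. A *v \<psi> x)"
proof -
  note ch = manifold_chartD[OF \<psi>]
  obtain B where B: "A ** B = mat 1" "B ** A = mat 1"
    using A unfolding invertible_det_nz[symmetric] invertible_def by blast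
  have BA: "B *v (A *v v) = v" "A *v (B *v v) = v" for v
    using B by (simp_all add: matrix_vector_mul_assoc)
  have bl: "bounded_linear ((*v) C)" for C :: "real^'d^'d" by (simp add: linear_linear)
  let ?\<psi> = "\<lambda>x. A *v \<psi> x"
  have inj: "inj_on ?\<psi> V" using ch(3) BA(1) by (metis (no_types, lifting) inj_on_def)
  have im: "?\<psi> ` V = (*v) B -` (\<psi> ` V)"
    by (auto simp: BA image_iff) (metis BA(2))
  have "open (?\<psi> ` V)"
    unfolding im using ch(2) bl by (simp add: linear_continuous_on open_vimage)
  moreover have "smooth_map_on V ?\<psi>"
    unfolding smooth_map_on_def
  proof
    fix x assume "x \<in> V"
    then obtain W F where W: "open W" "x \<in> W" "\<forall>k. cont_diff_on k F W" "\<forall>y\<in>V \<inter> W. F y = \<psi> y"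
      using ch(4) unfolding smooth_map_on_def by meson
    then show "\<exists>W F. open W \<and> x \<in> W \<and> (\<forall>k. cont_diff_on k F W) \<and> (\<forall>y\<in>V \<inter> W. F y = ?\<psi> y)"
      using cont_diff_on_linear_left[OF bl W(1)] by (intro exI[of _ W] exI[of _ "\<lambda>y. A *v F y"]) auto
  qed
  moreover have "smooth_map_on (?\<psi> ` V) (inv_into V ?\<psi>)"
    unfolding smooth_map_on_def
  proof
    fix y assume "y \<in> ?\<psi> ` V"
    then have "B *v y \<in> \<psi> ` V" using im by blast
    then obtain W G where W: "open W" "B *v y \<in> W" "\<forall>k. cont_diff_on k G W"
        "\<forall>z\<in>\<psi> ` V \<inter> W. G z = inv_into V \<psi> z"
      using ch(5) unfolding smooth_map_on_def by meson
    have "\<forall>k. cont_diff_on k (\<lambda>z. G (B *v z)) ((*v) B -` W)"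
      using cont_diff_on_linear_right[OF bl W(1)] W(3) by blast
    moreover have "open ((*v) B -` W)" using W(1) bl by (simp add: linear_continuous_on open_vimage)
    moreover have "G (B *v z) = inv_into V ?\<psi> z" if z: "z \<in> ?\<psi> ` V \<inter> (*v) B -` W" for z
    proof -
      obtain p where p: "p \<in> V" "z = A *v \<psi> p" using z by blast
      then have "G (B *v z) = p" using W(4) z manifold_chart_inv[OF \<psi> p(1)] by (simp add: BA)
      then show ?thesis using inv_into_f_f[OF inj p(1)] p(2) by simp
    qed
    ultimately show "\<exists>W F. open W \<and> y \<in> W \<and> (\<forall>k. cont_diff_on k F W) \<and>
        (\<forall>z\<in>?\<psi> ` V \<inter> W. F z = inv_into V ?\<psi> z)"
      using W(2) by (intro exI[of _ "(*v) B -` W"] exI[of _ "\<lambda>z. G (B *v z)"]) auto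
  qed
  ultimately show ?thesis
    using ch(1) inj by (simp add: manifold_chart_def diffeomorphism_on_def bij_betw_def)
qed

text \<open>What has to be shown is that the encoder has open image. Read in a chart \<psi> of
  \<open>M\<close> of the same dimension, the encoder is a continuous injection from an open set of
  the coordinate space into that space, and invariance of domain applies.\<close>

lemma smooth_autoencoder_chart_imp_manifold_chart:
  fixes E :: "real^'n \<Rightarrow> real^'d"
  assumes M: "smooth_manifold TYPE('d) M" and ch: "smooth_autoencoder_chart M U Z E D"
  shows "manifold_chart M U E"
proof -
  have U: "openin (top_of_set M) U" and diff: "diffeomorphism_on U (E ` U) E"
    and sm: "smooth_map_on U E"
    using ch by (auto simp: smooth_autoencoder_chart_def)
  have inj: "inj_on E U" using diff by (auto simp: diffeomorphism_on_def bij_betw_def)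
  have "open (E ` U)"
  proof (subst open_subopen, rule ballI)
    fix y assume "y \<in> E ` U"
    then obtain p where p: "p \<in> U" "y = E p" by blast
    then have "p \<in> M" using U openin_imp_subset by blast
    then obtain V and \<psi> :: "real^'n \<Rightarrow> real^'d" where V: "p \<in> V" "manifold_chart M V \<psi>"
      using M unfolding smooth_manifold_def by blast
    let ?A = "\<psi> ` (V \<inter> U)"
    have inv: "inv_into V \<psi> (\<psi> q) = q" if "q \<in> V" for q by (rule manifold_chart_inv[OF V(2) that])
    then have im: "inv_into V \<psi> ` ?A = V \<inter> U" by force
    have "open ((E \<circ> inv_into V \<psi>) ` ?A)"
    proof (rule invariance_of_domain)
      show "continuous_on ?A (E \<circ> inv_into V \<psi>)"
      proof (rule continuous_on_compose)
        show "continuous_on ?A (inv_into V \<psi>)"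
          by (rule continuous_on_subset[OF smooth_map_on_imp_continuous_on[OF manifold_chartD(5)[OF V(2)]]]) blast
        show "continuous_on (inv_into V \<psi> ` ?A) E"
          unfolding im by (rule continuous_on_subset[OF smooth_map_on_imp_continuous_on[OF sm]]) blast
      qed
      show "open ?A" by (rule manifold_chart_open_image[OF V(2) U])
      show "inj_on (E \<circ> inv_into V \<psi>) ?A"
        using inj inv by (auto simp: inj_on_def)
    qed
    then have "open (E ` (V \<inter> U))" by (simp only: image_comp[symmetric] im)
    then show "\<exists>T. open T \<and> y \<in> T \<and> T \<subseteq> E ` U" using p V(1) by blast
  qed
  then show ?thesis using U diff by (simp add: manifold_chart_def)
qed

text \<open>The decoder and the inverse of the encoder agree on the image of the overlap; that image
  is open, so the derivatives agree too.\<close>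

lemma lin_transition_eq_chart_jacobian:
  assumes i: "manifold_chart M (U i) (E i)" and j: "manifold_chart M (U j) (E j)"
    and D: "\<And>y. y \<in> U i \<Longrightarrow> D i (E i y) = y" and x: "x \<in> U i \<inter> U j"
  shows "lin_transition U E D j i x = chart_jacobian (U i) (E i) (U j) (E j) x"
proof -
  let ?S = "E i ` (U i \<inter> U j)"
  have S: "open ?S" by (rule manifold_chart_open_image[OF i manifold_chartD(1)[OF j]])
  have xS: "E i x \<in> ?S" using x by blast
  have "frechet_derivative (E j \<circ> inv_into (U i) (E i)) (at (E i x)) = frechet_derivative (E j \<circ> D i) (at (E i x))"
    using chart_jacobian_works[OF i j x]
    by (intro frechet_derivative_transform_within_open[OF _ S xS])
      (auto simp: differentiable_def D manifold_chart_inv[OF i])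
  then show ?thesis
    by (simp add: lin_transition_def chart_jacobian_def jacobian_def at_within_open[OF xS S])
qed

section \<open>Orientability of the manifold in terms of signs of charts\<close>

lemma orientable_manifold_chart_signs:
  fixes E :: "'i \<Rightarrow> real^'n \<Rightarrow> real^'d"
  assumes ori: "orientable_manifold TYPE('d) M"
    and ch: "\<And>i. i \<in> I \<Longrightarrow> manifold_chart M (U i) (E i)"
  obtains \<nu> :: "'i \<Rightarrow> real^'n \<Rightarrow> real" where
    "\<And>i. i \<in> I \<Longrightarrow> locally_constant_on (top_of_set M) (U i) (\<nu> i)"
    "\<And>i x. i \<in> I \<Longrightarrow> x \<in> U i \<Longrightarrow> \<nu> i x \<in> {-1, 1}"
    "\<And>i j x. i \<in> I \<Longrightarrow> j \<in> I \<Longrightarrow> x \<in> U i \<inter> U j \<Longrightarrow>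
       sgn (det (chart_jacobian (U i) (E i) (U j) (E j) x)) = \<nu> j x * \<nu> i x"
proof -
  obtain \<C> :: "((real^'n) set \<times> (real^'n \<Rightarrow> real^'d)) set" where
    \<C>: "\<And>V \<psi>. (V, \<psi>) \<in> \<C> \<Longrightarrow> manifold_chart M V \<psi>" and cov: "M \<subseteq> \<Union>(fst ` \<C>)"
    and pos: "\<And>V \<psi> V' \<psi>' x. (V, \<psi>) \<in> \<C> \<Longrightarrow> (V', \<psi>') \<in> \<C> \<Longrightarrow> x \<in> V \<inter> V' \<Longrightarrow>
        0 < det (chart_jacobian V \<psi> V' \<psi>' x)"
    using ori unfolding orientable_manifold_def chart_jacobian_def[symmetric] by fast
  have "\<forall>x\<in>M. \<exists>c. c \<in> \<C> \<and> x \<in> fst c" using cov by blast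
  then obtain c where c: "\<And>x. x \<in> M \<Longrightarrow> c x \<in> \<C> \<and> x \<in> fst (c x)" by metis
  define V where "V x = fst (c x)" for x
  define \<psi> where "\<psi> x = snd (c x)" for x
  have V\<psi>: "(V x, \<psi> x) \<in> \<C>" "x \<in> V x" if "x \<in> M" for x
    using c[OF that] by (simp_all add: V_def \<psi>_def)
  define \<nu> where "\<nu> i x = sgn (det (chart_jacobian (V x) (\<psi> x) (U i) (E i) x))" for i x
  have UM: "x \<in> M" if "i \<in> I" "x \<in> U i" for i x
    using manifold_chartD(6)[OF ch] that by blast
  \<comment> \<open>Transitions inside the oriented atlas have positive determinant, so the sign may
    be computed with any oriented chart around \<open>y\<close>. In particular one chart serves a
    whole neighbourhood, which yields local constancy.\<close>
  have \<nu>: "\<nu> i y = sgn (det (chart_jacobian W \<eta> (U i) (E i) y))"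
    if "i \<in> I" "y \<in> U i" "(W, \<eta>) \<in> \<C>" "y \<in> W" for i y W \<eta>
  proof -
    note y = V\<psi>[OF UM[OF that(1,2)]]
    have "0 < det (chart_jacobian (V y) (\<psi> y) W \<eta> y)"
      using pos[OF y(1) that(3)] y(2) that(4) by blast
    then show ?thesis
      using sgn_chart_jacobian_trans[OF \<C>[OF y(1)] \<C>[OF that(3)] ch[OF that(1)] y(2) that(4,2)]
      by (simp add: \<nu>_def)
  qed
  show thesis
  proof (rule that)
    fix i assume i: "i \<in> I"
    show "locally_constant_on (top_of_set M) (U i) (\<nu> i)"
      unfolding locally_constant_on_def
    proof
      fix x assume x: "x \<in> U i"
      note xV = V\<psi>[OF UM[OF i x]]
      obtain N where N: "openin (top_of_set M) N" "x \<in> N" and eq: "\<forall>y\<in>N \<inter> (V x \<inter> U i).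
          sgn (det (chart_jacobian (V x) (\<psi> x) (U i) (E i) y)) =
          sgn (det (chart_jacobian (V x) (\<psi> x) (U i) (E i) x))"
        using locally_constant_chart_sign[OF \<C>[OF xV(1)] ch[OF i]] x xV(2)
        unfolding locally_constant_on_def by (meson IntI)
      have "\<nu> i y = \<nu> i x" if "y \<in> (N \<inter> V x) \<inter> U i" for y
        using \<nu>[OF i _ xV(1), of y] eq that by (auto simp: \<nu>_def[of i x])
      moreover have "openin (top_of_set M) (N \<inter> V x)"
        using N(1) manifold_chartD(1)[OF \<C>[OF xV(1)]] by (rule openin_Int)
      ultimately show "\<exists>W. openin (top_of_set M) W \<and> x \<in> W \<and> (\<forall>y\<in>W \<inter> U i. \<nu> i y = \<nu> i x)"
        using N(2) xV(2) by blast
    qed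
  next
    fix i x assume "i \<in> I" "x \<in> U i"
    then show "\<nu> i x \<in> {-1, 1}"
      unfolding \<nu>_def using V\<psi>[OF UM] by (intro sgn_chart_jacobian_cases[OF \<C> ch]) auto
  next
    fix i j x assume i: "i \<in> I" and j: "j \<in> I" and x: "x \<in> U i \<inter> U j"
    note xV = V\<psi>[OF UM[OF i]]
    have xs: "x \<in> U i" "x \<in> U j" "x \<in> V x" using x xV(2) by auto
    \<comment> \<open>The transition between the two encoders is factored through the oriented chart
      chosen at \<open>x\<close>.\<close>
    have "sgn (det (chart_jacobian (U i) (E i) (U j) (E j) x)) =
        sgn (det (chart_jacobian (U i) (E i) (V x) (\<psi> x) x)) * \<nu> j x"
      unfolding \<nu>_def by (rule sgn_chart_jacobian_trans[OF ch[OF i] \<C>[OF xV(1)] ch[OF j] xs(1,3,2)]) (rule xs)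
    also have "sgn (det (chart_jacobian (U i) (E i) (V x) (\<psi> x) x)) = \<nu> i x"
      unfolding \<nu>_def by (rule sgn_chart_jacobian_sym[OF \<C>[OF xV(1)] ch[OF i] xs(3,1)]) (rule xs)
    finally show "sgn (det (chart_jacobian (U i) (E i) (U j) (E j) x)) = \<nu> j x * \<nu> i x" by simp
  qed
qed

text \<open>The signs are constant on each chart domain, so a single matrix of determinant
  \<open>\<nu> i\<close> corrects the whole encoder. The corrected encoders form an oriented
  atlas.\<close>

lemma orientable_manifold_of_chart_signs:
  fixes E :: "'i \<Rightarrow> real^'n \<Rightarrow> real^'d" and \<nu> :: "'i \<Rightarrow> real"
  assumes ch: "\<And>i. i \<in> I \<Longrightarrow> manifold_chart M (U i) (E i)" and cov: "M \<subseteq> (\<Union>i\<in>I. U i)"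
    and pm: "\<And>i. i \<in> I \<Longrightarrow> \<nu> i \<in> {-1, 1}"
    and co: "\<And>i j x. i \<in> I \<Longrightarrow> j \<in> I \<Longrightarrow> x \<in> U i \<inter> U j \<Longrightarrow>
       sgn (det (chart_jacobian (U i) (E i) (U j) (E j) x)) = \<nu> j * \<nu> i"
  shows "orientable_manifold TYPE('d) M"
proof -
  define E' where "E' i = (\<lambda>x. sign_matrix (\<nu> i) *v E i x)" for i
  have ch': "manifold_chart M (U i) (E' i)" if "i \<in> I" for i
    unfolding E'_def by (rule manifold_chart_linear[OF ch[OF that]]) (use pm[OF that] in auto)
  have EE': "sgn (det (chart_jacobian (U i) (E i) (U i) (E' i) x)) = \<nu> i" if "i \<in> I" "x \<in> U i" for i x
    using chart_jacobian_linear[OF ch[OF that(1)] ch'[OF that(1), unfolded E'_def] that(2)] pm[OF that(1)]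
    by (auto simp: E'_def)
  have pos: "0 < det (chart_jacobian (U i) (E' i) (U j) (E' j) x)"
    if i: "i \<in> I" and j: "j \<in> I" and x: "x \<in> U i" "x \<in> U j" for i j x
  proof -
    \<comment> \<open>The path from one corrected encoder to the other runs through the two original
      ones; each correction contributes its sign, and every sign then occurs twice.\<close>
    have "sgn (det (chart_jacobian (U i) (E' i) (U j) (E' j) x)) =
        sgn (det (chart_jacobian (U i) (E' i) (U i) (E i) x)) *
        (sgn (det (chart_jacobian (U i) (E i) (U j) (E j) x)) *
         sgn (det (chart_jacobian (U j) (E j) (U j) (E' j) x)))"
      using sgn_chart_jacobian_trans[OF ch'[OF i] ch[OF i] ch'[OF j] x(1,1,2)]
        sgn_chart_jacobian_trans[OF ch[OF i] ch[OF j] ch'[OF j] x(1,2,2)] by simp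
    also have "\<dots> = \<nu> i * (\<nu> j * \<nu> i * \<nu> j)"
      using co[OF i j] x EE'[OF i x(1)] EE'[OF j x(2)] sgn_chart_jacobian_sym[OF ch[OF i] ch'[OF i] x(1,1)]
      by simp
    also have "\<dots> = 1" using pm[OF i] pm[OF j] by auto
    finally show ?thesis by (simp add: sgn_1_pos)
  qed
  show ?thesis
    unfolding orientable_manifold_def chart_jacobian_def[symmetric]
  proof (intro exI[of _ "(\<lambda>i. (U i, E' i)) ` I"] conjI)
    show "M \<subseteq> \<Union>(fst ` (\<lambda>i. (U i, E' i)) ` I)" using cov by (auto simp: image_image)
  qed (use ch' pos in auto)
qed

section \<open>The bundle of an autoencoder atlas\<close>

lemma openin_quotient_topology:
  assumes "equiv (topspace X) R"
  shows "openin (quotient_topology X R) \<U> \<longleftrightarrow> \<U> \<subseteq> topspace X // R \<and> openin X (\<Union>\<U>)"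
  unfolding quotient_topology_def topology_inverse'[OF istopology_quotient[OF assms]] ..

lemma topspace_quotient_topology:
  assumes "equiv (topspace X) R"
  shows "topspace (quotient_topology X R) = topspace X // R"
proof -
  have "openin (quotient_topology X R) (topspace X // R)"
    by (simp add: openin_quotient_topology[OF assms] Union_quotient[OF assms])
  then show ?thesis
    using openin_quotient_topology[OF assms] by (metis openin_subset openin_topspace subset_antisym)
qed

section \<open>The linearised transitions and the gluing relation\<close>

locale autoencoder_atlas =
  fixes M :: "(real^'n) set" and I :: "'i set"
    and U :: "'i \<Rightarrow> (real^'n) set" and Z :: "'i \<Rightarrow> (real^'d) set"
    and E :: "'i \<Rightarrow> real^'n \<Rightarrow> real^'d" and D :: "'i \<Rightarrow> real^'d \<Rightarrow> real^'n"
  assumes manifold: "smooth_manifold TYPE('d) M"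
    and atlas: "smooth_autoencoder_atlas M I U Z E D"
begin

abbreviation g :: "'i \<Rightarrow> 'i \<Rightarrow> real^'n \<Rightarrow> real^'d^'d" where
  "g \<equiv> lin_transition U E D"

abbreviation R :: "('i \<times> (real^'n) \<times> (real^'d)) rel" where
  "R \<equiv> atlas_rel I U E D"

abbreviation \<xi> :: "(('i \<times> (real^'n) \<times> (real^'d)) set, real^'n) vbundle" where
  "\<xi> \<equiv> atlas_bundle M I U E D"

lemma cover: "(\<Union>i\<in>I. U i) = M"
  using atlas by (simp add: smooth_autoencoder_atlas_def)

lemma chart: "i \<in> I \<Longrightarrow> manifold_chart M (U i) (E i)"
  using atlas unfolding smooth_autoencoder_atlas_def
  by (intro smooth_autoencoder_chart_imp_manifold_chart[OF manifold, of _ "Z i" _ "D i"]) simp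

lemma decoder: "i \<in> I \<Longrightarrow> x \<in> U i \<Longrightarrow> D i (E i x) = x"
  using atlas by (simp add: smooth_autoencoder_atlas_def smooth_autoencoder_chart_def)

lemma g_eq: "i \<in> I \<Longrightarrow> j \<in> I \<Longrightarrow> x \<in> U i \<Longrightarrow> x \<in> U j \<Longrightarrow>
    g j i x = chart_jacobian (U i) (E i) (U j) (E j) x"
  by (rule lin_transition_eq_chart_jacobian[where M = M]) (auto simp: chart decoder)

lemma g_self: "i \<in> I \<Longrightarrow> x \<in> U i \<Longrightarrow> g i i x = mat 1"
  by (simp add: g_eq chart_jacobian_self[OF chart])

lemma g_trans:
  "i \<in> I \<Longrightarrow> j \<in> I \<Longrightarrow> k \<in> I \<Longrightarrow> x \<in> U i \<Longrightarrow> x \<in> U j \<Longrightarrow> x \<in> U k \<Longrightarrow> g k j x ** g j i x = g k i x"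
  by (simp add: g_eq chart_jacobian_trans[OF chart chart chart, symmetric])

lemma continuous_on_g:
  assumes "i \<in> I" "j \<in> I" shows "continuous_on (U i \<inter> U j) (\<lambda>x. g j i x $ k $ l)"
  by (rule continuous_on_eq[OF continuous_on_chart_jacobian[OF chart[OF assms(1)] chart[OF assms(2)]]])
    (simp add: g_eq assms)

lemma subset_M: "i \<in> I \<Longrightarrow> U i \<subseteq> M"
  using cover by blast

text \<open>Expresses each summand of the disjoint union as a subspace of a Euclidean space, where
  \<open>continuous_on\<close> and relative openness are available.\<close>

lemma prod_topology_chart:
  "i \<in> I \<Longrightarrow> prod_topology (subtopology (top_of_set M) (U i)) euclidean = top_of_set (U i \<times> (UNIV :: (real^'d) set))"
  using subset_M[of i] prod_topology_subtopology_eu[of "U i" "UNIV :: (real^'d) set"]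
  by (simp add: subtopology_subtopology Int_absorb1)

lemma topspace_atlas_space: "topspace (atlas_space M I U) = {(i, x, v). i \<in> I \<and> x \<in> U i}"
  using subset_M by (fastforce simp: atlas_space_def)

lemma atlas_rel_iff:
  "((i, x, v), (j, y, w)) \<in> R \<longleftrightarrow> i \<in> I \<and> j \<in> I \<and> x \<in> U i \<and> x \<in> U j \<and> y = x \<and> w = g j i x *v v"
  by (auto simp: atlas_rel_def)

text \<open>The equivalence axioms are the cocycle relations \<open>g_self\<close> and
  \<open>g_trans\<close>.\<close>

lemma equiv_atlas_rel: "equiv (topspace (atlas_space M I U)) R"
proof (rule equivI)
  show "R \<subseteq> topspace (atlas_space M I U) \<times> topspace (atlas_space M I U)"
    by (auto simp: topspace_atlas_space atlas_rel_iff)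
  show "refl_on (topspace (atlas_space M I U)) R"
    by (auto simp: refl_on_def topspace_atlas_space atlas_rel_iff g_self)
  show "sym R"
  proof (rule symI)
    fix a b assume "(a, b) \<in> R"
    then show "(b, a) \<in> R"
      by (cases a; cases b) (auto simp: atlas_rel_iff matrix_vector_mul_assoc g_trans g_self)
  qed
  show "trans R"
  proof (rule transI)
    fix a b c assume "(a, b) \<in> R" "(b, c) \<in> R"
    then show "(a, c) \<in> R"
      by (cases a; cases b; cases c) (auto simp: atlas_rel_iff matrix_vector_mul_assoc g_trans)
  qed
qed

section \<open>The tautological trivializations of the glued bundle\<close>

definition triv :: "'i \<Rightarrow> (real^'n) \<times> (real^'d) \<Rightarrow> ('i \<times> (real^'n) \<times> (real^'d)) set" where
  "triv i p = R `` {(i, p)}"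

lemma mem_triv:
  "i \<in> I \<Longrightarrow> x \<in> U i \<Longrightarrow>
    (j, y, w) \<in> triv i (x, v) \<longleftrightarrow> j \<in> I \<and> x \<in> U j \<and> y = x \<and> w = g j i x *v v"
  by (auto simp: triv_def atlas_rel_iff)

lemma triv_change:
  assumes "i \<in> I" "j \<in> I" "x \<in> U i" "x \<in> U j"
  shows "triv i (x, v) = triv j (x, g j i x *v v)"
  unfolding triv_def by (rule equiv_class_eq[OF equiv_atlas_rel]) (simp add: atlas_rel_iff assms)

lemma triv_inject:
  assumes "i \<in> I" "x \<in> U i" "y \<in> U i" "triv i (x, v) = triv i (y, w)"
  shows "x = y \<and> v = w"
proof -
  have "(i, x, v) \<in> triv i (y, w)"
    using mem_triv[OF assms(1,2), of i x v v] assms g_self[OF assms(1,2)] by simp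
  then show ?thesis using mem_triv[OF assms(1,3)] g_self[OF assms(1,3)] by simp
qed

lemma base_space_atlas_bundle: "base_space \<xi> = top_of_set M"
  by (simp add: atlas_bundle_def)

lemma openin_total_space:
  "openin (total_space \<xi>) \<U> \<longleftrightarrow>
     \<U> \<subseteq> topspace (atlas_space M I U) // R \<and> openin (atlas_space M I U) (\<Union>\<U>)"
  by (simp add: atlas_bundle_def openin_quotient_topology[OF equiv_atlas_rel])

lemma topspace_total_space:
  "topspace (total_space \<xi>) = {triv i (x, v) | i x v. i \<in> I \<and> x \<in> U i}"
proof -
  have "topspace (total_space \<xi>) = topspace (atlas_space M I U) // R"
    by (simp add: atlas_bundle_def topspace_quotient_topology[OF equiv_atlas_rel])
  then show ?thesis
    by (auto simp: quotient_def topspace_atlas_space triv_def)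
qed

lemma proj_triv:
  assumes "i \<in> I" "x \<in> U i" shows "proj \<xi> (triv i (x, v)) = x"
proof -
  have "(THE y. \<exists>j w. (j, y, w) \<in> triv i (x, v)) = x"
    by (rule the_equality) (use assms mem_triv[OF assms] in blast)+
  then show ?thesis by (simp add: atlas_bundle_def)
qed

lemma fibre_atlas_bundle:
  assumes "i \<in> I" "x \<in> U i" shows "fibre \<xi> x = range (\<lambda>v. triv i (x, v))"
proof
  show "fibre \<xi> x \<subseteq> range (\<lambda>v. triv i (x, v))"
  proof
    fix e assume "e \<in> fibre \<xi> x"
    then obtain j y v where e: "e = triv j (y, v)" "j \<in> I" "y \<in> U j" "proj \<xi> e = x"
      by (auto simp: fibre_def topspace_total_space)
    then have "y = x" using proj_triv by simp
    then show "e \<in> range (\<lambda>v. triv i (x, v))" using triv_change[of j i x v] e assms by auto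
  qed
  show "range (\<lambda>v. triv i (x, v)) \<subseteq> fibre \<xi> x"
    using assms proj_triv[OF assms] by (auto simp: fibre_def topspace_total_space)
qed

text \<open>Linearity can be checked in each chart: there the fibre operations are the vector
  operations, and the transition matrices respect them.\<close>

lemma frame_at_triv:
  assumes i: "i \<in> I" and x: "x \<in> U i" shows "frame_at \<xi> x (\<lambda>v. triv i (x, v))"
  unfolding frame_at_def
proof (intro conjI allI)
  show "bij_betw (\<lambda>v. triv i (x, v)) UNIV (fibre \<xi> x)"
    using triv_inject[OF i x x] by (auto simp: bij_betw_def inj_on_def fibre_atlas_bundle[OF assms])
  show "triv i (x, v + w) = fadd \<xi> (triv i (x, v)) (triv i (x, w))" for v w
    by (auto simp: atlas_bundle_def mem_triv[OF assms] matrix_vector_right_distrib)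
  show "triv i (x, a *\<^sub>R v) = fscale \<xi> a (triv i (x, v))" for a v
    by (auto simp: atlas_bundle_def mem_triv[OF assms] matrix_vector_mult_scaleR)
qed

lemma continuous_map_triv:
  assumes i: "i \<in> I"
  shows "continuous_map (top_of_set (U i \<times> UNIV)) (total_space \<xi>) (triv i)"
  unfolding continuous_map_def
proof (intro conjI allI impI)
  show "triv i \<in> topspace (top_of_set (U i \<times> UNIV)) \<rightarrow> topspace (total_space \<xi>)"
    using i by (auto simp: topspace_total_space)
  fix \<U> assume \<U>: "openin (total_space \<xi>) \<U>"
  \<comment> \<open>A union of equivalence classes contains a triple iff the whole class of that
    triple is one of its members. Hence the preimage of an open set is the slice at \<open>i\<close>
    of its union, which is open in the disjoint union.\<close>
  have "triv i (x, v) \<in> \<U> \<longleftrightarrow> (i, x, v) \<in> \<Union>\<U>" if x: "x \<in> U i" for x v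
  proof
    assume "triv i (x, v) \<in> \<U>"
    then show "(i, x, v) \<in> \<Union>\<U>" using mem_triv[OF i x, of i x v v] i x g_self[OF i x] by auto
  next
    assume "(i, x, v) \<in> \<Union>\<U>"
    then obtain e where e: "e \<in> \<U>" "(i, x, v) \<in> e" by blast
    have "e \<in> topspace (atlas_space M I U) // R" using e(1) \<U> openin_total_space by blast
    then obtain a where a: "e = R `` {a}" by (rule quotientE)
    then have "R `` {(i, x, v)} = e"
      using equiv_class_eq[OF equiv_atlas_rel, of a "(i, x, v)"] e(2) by simp
    then show "triv i (x, v) \<in> \<U>" using e(1) by (simp add: triv_def)
  qed
  then have "{p \<in> topspace (top_of_set (U i \<times> UNIV)). triv i p \<in> \<U>} =
      {p. (i, p) \<in> \<Union>\<U>} \<inter> (U i \<times> UNIV)"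
    by auto
  also have "\<dots> = {p. (i, p) \<in> \<Union>\<U>}"
    using openin_subset[of "atlas_space M I U" "\<Union>\<U>"] \<U> openin_total_space
    by (fastforce simp: topspace_atlas_space)
  finally show "openin (top_of_set (U i \<times> UNIV)) {p \<in> topspace (top_of_set (U i \<times> UNIV)). triv i p \<in> \<U>}"
    using \<U> i by (simp add: openin_total_space atlas_space_def openin_sum_topology prod_topology_chart)
qed

text \<open>Openness in the quotient is tested on every summand. The slice at \<open>j\<close> is
  the preimage of \<open>W\<close> under the change of coordinates from chart \<open>j\<close> to
  chart \<open>i\<close>, which is continuous on the overlap.\<close>

lemma openin_triv_image:
  assumes i: "i \<in> I" and W: "openin (top_of_set (U i \<times> UNIV)) W"
  shows "openin (total_space \<xi>) (triv i ` W)"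
  unfolding openin_total_space
proof
  have WU: "x \<in> U i" if "(x, v) \<in> W" for x v
    using W that openin_imp_subset by blast
  obtain T where T: "open T" "W = (U i \<times> UNIV) \<inter> T" using W openin_open by blast
  show sub: "triv i ` W \<subseteq> topspace (atlas_space M I U) // R"
    using i WU by (auto simp: triv_def topspace_atlas_space intro!: quotientI)
  have slice: "openin (top_of_set (U j \<times> UNIV)) {p. (j, p) \<in> \<Union>(triv i ` W)}" if j: "j \<in> I" for j
  proof -
    let ?S = "(U j \<inter> U i) \<times> (UNIV :: (real^'d) set)"
    \<comment> \<open>The gluing map that rewrites coordinates of chart \<open>j\<close> in chart
      \<open>i\<close>.\<close>
    let ?h = "\<lambda>p. (fst p, g i j (fst p) *v snd p)"
    have cg: "continuous_on ?S (\<lambda>p. g i j (fst p) $ k $ l)" for k l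
      by (rule continuous_on_compose2[OF continuous_on_g[OF j i] continuous_on_fst[OF continuous_on_id]]) auto
    have "continuous_on ?S ?h"
      unfolding matrix_vector_mult_def
      by (intro continuous_on_Pair continuous_on_vec_lambda continuous_on_sum continuous_on_mult)
        (rule cg | intro continuous_intros)+
    then have 1: "openin (top_of_set ?S) (?S \<inter> ?h -` T)"
      by (rule continuous_openin_preimage_gen[OF _ T(1)])
    \<comment> \<open>An ambient open set cutting \<open>U i\<close> out of \<open>M\<close> also
      cuts the overlap out of \<open>U j\<close>.\<close>
    have 2: "openin (top_of_set (U j \<times> UNIV)) ?S"
    proof -
      obtain A where A: "open A" "U i = M \<inter> A"
        using manifold_chartD(1)[OF chart[OF i]] openin_open by blast
      then have "?S = (U j \<times> UNIV) \<inter> (A \<times> UNIV)" using subset_M[OF j] by blast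
      moreover have "open (A \<times> (UNIV :: (real^'d) set))" using A(1) by (simp add: open_Times)
      ultimately show ?thesis by (simp add: openin_open_Int)
    qed
    have 3: "{p. (j, p) \<in> \<Union>(triv i ` W)} = ?S \<inter> ?h -` T"
    proof (intro subset_antisym subsetI)
      fix p assume "p \<in> {p. (j, p) \<in> \<Union>(triv i ` W)}"
      then obtain x v where xv: "(x, v) \<in> W" "(j, p) \<in> triv i (x, v)" by auto
      then have x: "x \<in> U i" using WU by blast
      obtain y w where p: "p = (y, w)" by (cases p)
      have "x \<in> U j" "y = x" "w = g j i x *v v"
        using xv(2) mem_triv[OF i x] p by auto
      moreover from this have "g i j x *v w = v"
        using x i j by (simp add: matrix_vector_mul_assoc g_trans g_self)
      ultimately show "p \<in> ?S \<inter> ?h -` T" using xv(1) x T(2) p by auto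
    next
      fix p assume p: "p \<in> ?S \<inter> ?h -` T"
      obtain y w where yw: "p = (y, w)" by (cases p)
      have y: "y \<in> U j" "y \<in> U i" "(y, g i j y *v w) \<in> W" using p yw T(2) by auto
      have "(j, y, w) \<in> triv i (y, g i j y *v w)"
        using y i j by (simp add: mem_triv matrix_vector_mul_assoc g_trans g_self)
      then show "p \<in> {p. (j, p) \<in> \<Union>(triv i ` W)}" using y(3) yw by blast
    qed
    show ?thesis unfolding 3 by (rule openin_trans[OF 1 2])
  qed
  have "\<Union>(triv i ` W) \<subseteq> topspace (atlas_space M I U)"
    using sub Union_quotient[OF equiv_atlas_rel] by blast
  then have "\<Union>(triv i ` W) \<subseteq> Sigma I (topspace \<circ> (\<lambda>i. prod_topology (subtopology (top_of_set M) (U i)) euclidean))"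
    by (simp add: atlas_space_def)
  with slice show "openin (atlas_space M I U) (\<Union>(triv i ` W))"
    unfolding atlas_space_def openin_sum_topology by (simp add: prod_topology_chart)
qed

lemma local_trivialization_triv:
  assumes i: "i \<in> I" shows "local_trivialization \<xi> (U i) (triv i)"
  unfolding local_trivialization_def base_space_atlas_bundle prod_topology_chart[OF i]
proof (intro conjI ballI frame_at_triv[OF i])
  let ?T = "{e \<in> topspace (total_space \<xi>). proj \<xi> e \<in> U i}"
  show "openin (top_of_set M) (U i)" by (rule manifold_chartD(1)[OF chart[OF i]])
  have im: "triv i ` (U i \<times> UNIV) = ?T"
  proof
    show "triv i ` (U i \<times> UNIV) \<subseteq> ?T" using i by (auto simp: proj_triv topspace_total_space)
    show "?T \<subseteq> triv i ` (U i \<times> UNIV)"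
    proof
      fix e assume "e \<in> ?T"
      then have "e \<in> fibre \<xi> (proj \<xi> e)" "proj \<xi> e \<in> U i" by (auto simp: fibre_def)
      then show "e \<in> triv i ` (U i \<times> UNIV)" using fibre_atlas_bundle[OF i] by auto
    qed
  qed
  have T: "?T \<subseteq> topspace (total_space \<xi>)" by blast
  show "homeomorphic_map (top_of_set (U i \<times> UNIV)) (subtopology (total_space \<xi>) ?T) (triv i)"
  proof (rule bijective_open_imp_homeomorphic_map)
    show "continuous_map (top_of_set (U i \<times> UNIV)) (subtopology (total_space \<xi>) ?T) (triv i)"
      by (rule continuous_map_into_subtopology[OF continuous_map_triv[OF i]]) (use im in auto)
    show "open_map (top_of_set (U i \<times> UNIV)) (subtopology (total_space \<xi>) ?T) (triv i)"
      unfolding open_map_def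
    proof (intro allI impI)
      fix W assume W: "openin (top_of_set (U i \<times> (UNIV :: (real^'d) set))) W"
      then have "triv i ` W \<subseteq> ?T" using im openin_imp_subset by blast
      with openin_triv_image[OF i W] show "openin (subtopology (total_space \<xi>) ?T) (triv i ` W)"
        unfolding openin_subtopology by (intro exI[of _ "triv i ` W"]) blast
    qed
    show "triv i ` topspace (top_of_set (U i \<times> UNIV)) = topspace (subtopology (total_space \<xi>) ?T)"
      using im T by auto
    show "inj_on (triv i) (topspace (top_of_set (U i \<times> UNIV)))"
      using triv_inject[OF i] by (auto simp: inj_on_def)
  qed
qed

section \<open>Comparison of the orientability conditions\<close>

lemma frame_sign_triv:
  assumes "i \<in> I" "j \<in> I" "x \<in> U i \<inter> U j"
  shows "frame_sign (\<lambda>v. triv i (x, v)) (\<lambda>v. triv j (x, v)) = jacobian_sign U E D j i x"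
proof -
  have x: "x \<in> U i" "x \<in> U j" using assms(3) by auto
  show ?thesis
    unfolding frame_sign_def jacobian_sign_def
    by (subst frame_change_eqI[OF frame_at_triv[OF assms(1) x(1)] frame_at_triv[OF assms(2) x(2)]
          triv_change[OF assms(1,2) x]]) (rule refl)
qed

lemma orientable_atlas_bundle_iff:
  "orientable_bundle TYPE('d) \<xi> \<longleftrightarrow> sign_coboundary M I U (jacobian_sign U E D)"
proof -
  have sign: "(\<forall>i\<in>I. \<forall>j\<in>I. \<forall>x\<in>U i \<inter> U j.
      frame_sign (\<lambda>v. triv i (x, v)) (\<lambda>v. triv j (x, v)) = \<nu> j x * \<nu> i x) \<longleftrightarrow>
    (\<forall>i\<in>I. \<forall>j\<in>I. \<forall>x\<in>U i \<inter> U j. jacobian_sign U E D j i x = \<nu> j x * \<nu> i x)" for \<nu>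
    by (intro ball_cong refl) (simp only: frame_sign_triv)
  have "(\<Union>i\<in>I. U i) = topspace (base_space \<xi>)" by (simp add: cover base_space_atlas_bundle)
  from orientable_bundle_iff_sign_coboundary[OF local_trivialization_triv this] show ?thesis
    unfolding sign_coboundary_def base_space_atlas_bundle sign by blast
qed

lemma stiefel_whitney_atlas_bundle_iff:
  "stiefel_whitney_1 TYPE('d) \<xi> = \<one>\<^bsub>cech_H1 (top_of_set M)\<^esub> \<longleftrightarrow> orientable_bundle TYPE('d) \<xi>"
proof -
  have "\<forall>p\<in>M. \<exists>i. i \<in> I \<and> p \<in> U i" using cover by blast
  \<comment> \<open>The class is defined by covers indexed by the points of the base, so one chart
    around each point is selected.\<close>
  then obtain i where "\<And>p. p \<in> M \<Longrightarrow> i p \<in> I \<and> p \<in> U (i p)" by metis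
  then have "trivialization_system \<xi> (\<lambda>p. U (i p)) (\<lambda>p. triv (i p))"
    by (simp add: trivialization_system_def base_space_atlas_bundle local_trivialization_triv)
  from stiefel_whitney_1_trivial_iff_orientable[OF this] show ?thesis
    by (simp add: base_space_atlas_bundle)
qed

text \<open>Three implications closing a cycle: orientability of \<open>M\<close> splits the
  cocycle, a splitting can be made constant on each chart domain, and constant signs orient
  \<open>M\<close>. Connectedness of the domains enters in the second.\<close>

lemma
  assumes conn: "\<And>i. i \<in> I \<Longrightarrow> connected (U i)"
  shows orientable_manifold_iff: "orientable_manifold TYPE('d) M \<longleftrightarrow> sign_coboundary M I U (jacobian_sign U E D)"
    and sign_coboundary_iff: "sign_coboundary M I U (jacobian_sign U E D) \<longleftrightarrow>
      (\<exists>\<nu> :: 'i \<Rightarrow> real. (\<forall>i\<in>I. \<nu> i \<in> {-1, 1}) \<and>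
         (\<forall>i\<in>I. \<forall>j\<in>I. \<forall>x\<in>U i \<inter> U j. sgn (det (g j i x)) = \<nu> j * \<nu> i))" (is "_ \<longleftrightarrow> ?const")
proof -
  have 1: "sign_coboundary M I U (jacobian_sign U E D)" if ori: "orientable_manifold TYPE('d) M"
  proof -
    obtain \<nu> :: "'i \<Rightarrow> real^'n \<Rightarrow> real" where
      "\<And>i. i \<in> I \<Longrightarrow> locally_constant_on (top_of_set M) (U i) (\<nu> i)"
      "\<And>i x. i \<in> I \<Longrightarrow> x \<in> U i \<Longrightarrow> \<nu> i x \<in> {-1, 1}"
      "\<And>i j x. i \<in> I \<Longrightarrow> j \<in> I \<Longrightarrow> x \<in> U i \<inter> U j \<Longrightarrow>
       sgn (det (chart_jacobian (U i) (E i) (U j) (E j) x)) = \<nu> j x * \<nu> i x"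
      using orientable_manifold_chart_signs[where U = U and E = E, OF ori chart] by blast
    then show ?thesis
      unfolding sign_coboundary_def jacobian_sign_def
      by (intro exI[of _ \<nu>]) (auto simp: g_eq)
  qed
  have 2: ?const if sc: "sign_coboundary M I U (jacobian_sign U E D)"
  proof -
    obtain \<nu> :: "'i \<Rightarrow> real^'n \<Rightarrow> real" where
      \<nu>: "\<forall>i\<in>I. locally_constant_on (top_of_set M) (U i) (\<nu> i) \<and> \<nu> i ` U i \<subseteq> {-1, 1}"
      and co: "\<forall>i\<in>I. \<forall>j\<in>I. \<forall>x\<in>U i \<inter> U j. jacobian_sign U E D j i x = \<nu> j x * \<nu> i x"
      using sc unfolding sign_coboundary_def by (elim exE conjE)
    \<comment> \<open>The constant value of \<open>\<nu> i\<close>, read off at an arbitrary point.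
      An empty domain gets the value 1, so that every chart still has a sign.\<close>
    define \<mu> where "\<mu> i = (if U i = {} then 1 else \<nu> i (SOME x. x \<in> U i))" for i
    have \<mu>: "\<nu> i x = \<mu> i" if "i \<in> I" "x \<in> U i" for i x
    proof -
      have "(SOME x. x \<in> U i) \<in> U i" using that(2) by (rule someI)
      then show ?thesis
        using locally_constant_on_connected[of M "U i" "\<nu> i" x "SOME x. x \<in> U i"] \<nu> that subset_M conn
        by (auto simp: \<mu>_def)
    qed
    have "\<mu> i \<in> {-1, 1}" if "i \<in> I" for i
    proof (cases "U i = {}")
      case False
      then obtain x where "x \<in> U i" by blast
      then show ?thesis using \<mu>[OF that] \<nu> that by (metis image_subset_iff)
    qed (simp add: \<mu>_def)
    moreover have "sgn (det (g j i x)) = \<mu> j * \<mu> i" if "i \<in> I" "j \<in> I" "x \<in> U i \<inter> U j" for i j x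
      using co \<mu>[OF that(1)] \<mu>[OF that(2)] that by (auto simp: jacobian_sign_def)
    ultimately show ?thesis by blast
  qed
  have 3: "orientable_manifold TYPE('d) M" if const: ?const
  proof -
    obtain \<nu> :: "'i \<Rightarrow> real" where "\<forall>i\<in>I. \<nu> i \<in> {-1, 1}"
      "\<forall>i\<in>I. \<forall>j\<in>I. \<forall>x\<in>U i \<inter> U j. sgn (det (g j i x)) = \<nu> j * \<nu> i"
      using const by blast
    then show ?thesis
      by (intro orientable_manifold_of_chart_signs[of I M U E \<nu>])
        (auto simp: chart cover g_eq[symmetric])
  qed
  show "orientable_manifold TYPE('d) M \<longleftrightarrow> sign_coboundary M I U (jacobian_sign U E D)"
    "sign_coboundary M I U (jacobian_sign U E D) \<longleftrightarrow> ?const"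
    using 1 2 3 by blast+
qed

end

theorem proposition3p16:
  fixes M :: "(real^'n) set" and I :: "'i set"
    and U :: "'i \<Rightarrow> (real^'n) set" and Z :: "'i \<Rightarrow> (real^'d) set"
    and E :: "'i \<Rightarrow> real^'n \<Rightarrow> real^'d" and D :: "'i \<Rightarrow> real^'d \<Rightarrow> real^'n"
  assumes "smooth_manifold TYPE('d) M" and "compact M" and "connected M"
    and "smooth_autoencoder_atlas M I U Z E D"
    and "good_cover M I U"
  shows "(orientable_bundle TYPE('d) (atlas_bundle M I U E D) \<longleftrightarrow>
            stiefel_whitney_1 TYPE('d) (atlas_bundle M I U E D) = \<one>\<^bsub>cech_H1 (top_of_set M)\<^esub>) \<and>
         (stiefel_whitney_1 TYPE('d) (atlas_bundle M I U E D) = \<one>\<^bsub>cech_H1 (top_of_set M)\<^esub> \<longleftrightarrow>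
            sign_coboundary M I U (jacobian_sign U E D)) \<and>
         (sign_coboundary M I U (jacobian_sign U E D) \<longleftrightarrow>
            (\<exists>\<nu> :: 'i \<Rightarrow> real. (\<forall>i\<in>I. \<nu> i \<in> {-1, 1}) \<and>
               (\<forall>i\<in>I. \<forall>j\<in>I. \<forall>x\<in>U i \<inter> U j.
                  sgn (det (lin_transition U E D j i x)) = \<nu> j * \<nu> i))) \<and>
         (bundle_isomorphic (atlas_bundle M I U E D) (tangent_bundle M) \<longrightarrow>
            (orientable_bundle TYPE('d) (atlas_bundle M I U E D) \<longleftrightarrow> orientable_manifold TYPE('d) M))"
proof -
  interpret autoencoder_atlas M I U Z E D
    using assms(1,4) by unfold_locales
  have conn: "connected (U i)" if "i \<in> I" for i
    using assms(5) that by (simp add: good_cover_def contractible_imp_connected)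
  show ?thesis
    using orientable_atlas_bundle_iff stiefel_whitney_atlas_bundle_iff orientable_manifold_iff[OF conn]
      sign_coboundary_iff[OF conn]
    by blast
qed

end
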